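(* Let $p \geq 3$ be a prime and $x, y \in \mathbb{Z}$ with $x^2 - 2 = y^p$ and $y \neq -1$. Then $p \leq 1951$. Moreover, if $911 < p \leq 1951$, then: $y < 10^{800}$ if $p = 919$; $y < 10^{300}$ if $p = 929$; $y < 10^{150}$ if $p \in \{937, 941\}$; $y < 10^{100}$ if $947 \leq p \leq 1200$; and $y < 10^{50}$ if $1200 \leq p \leq 1951$.
   Context: A solution $(x,y)$ of $x^2-2=y^p$ is called nontrivial if $y \neq -1$. *)

theory Defs
  imports "HOL-Computational_Algebra.Primes"
begin

end

theory Submission
  imports Defs "Jordan_Normal_Form.Determinant" "HOL-Analysis.Convex"
begin

text \<open>
  In \<open>\<int>[\<surd>2]\<close>, with fundamental unit \<open>\<epsilon> = 1 + \<surd>2\<close>, a solution gives \<open>x + \<surd>2 = \<epsilon>\<^sup>r \<alpha>\<^sup>p\<close> with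
  \<open>0 < \<bar>r\<bar> < p / 2\<close> and \<open>N(\<alpha>) = \<plusminus>y\<close>. Hence \<open>\<gamma> = \<plusminus>\<alpha>'/\<alpha>\<close> makes the linear form
  \<open>\<Lambda> = p ln \<gamma> - r ln \<epsilon>\<^sup>2\<close> at most \<open>6 exp (- (p / 2) ln y)\<close> in absolute value. A lower bound for \<open>\<Lambda>\<close> comes from
  an interpolation determinant \<open>\<Delta>\<close> in the style of Laurent, Mignotte and Nesterenko: its rows are the
  functions \<open>binomial(z, k) u\<^sup>l\<close> with \<open>k < K\<close> and \<open>\<bar>l\<bar> \<le> h\<close>, evaluated at points
  \<open>z = p i + r j\<close>, \<open>u = \<epsilon>\<^sup>2\<^sup>i \<gamma>\<^sup>j\<close>, and \<open>u\<close> is nearly a function of \<open>z\<close> because \<open>\<Lambda>\<close> is small.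

  Two features make the constants good enough without any information on \<open>r\<close>. Conjugation in
  \<open>\<rat>(\<surd>2)\<close> inverts both \<open>\<epsilon>\<^sup>2\<close> and \<open>\<gamma>\<close>, so it maps \<open>\<Delta>\<close> to \<open>\<plusminus>\<Delta>\<close> and Liouville's inequality loses
  nothing at the second place. And since the points \<open>z\<close> are real, the upper bound for \<open>\<Delta>\<close> can be
  taken from Chebyshev expansions on an interval instead of power series on a disc.

  The base \<open>y = 7\<close> is too small for this argument and is excluded by a Pell equation.
\<close>

subsection \<open>Upper bounds for determinants from Chebyshev expansions\<close>

text \<open>Two demands squeeze the parameters. Write L = 2 h + 1, N = K L for the size of the
  determinant, and v = ln y. Treating \<open>u\<close> as a function of \<open>z\<close> makes an
  error of order \<Lambda>, which is harmless only if 2 N stays below (p / 2) v. On the other side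
  the gain of about N^2 must beat the binomials, the exponentials and the arithmetic loss; after
  division by N K the right side is L and the left side has a constant near 4, which L = 9 can
  afford. With K = 5.95 L v the first demand is roughly p >= 24 L^2, and 24 * 9^2 = 1944 lies just
  below 1952. For large y the smaller choice K = 25 v already works with L = 9, and the first demand
  becomes 456 <= p / 2, that is p >= 912. Hence one bound 10^50 serves all p above 911. L / K must
  be small, so v must not be: ln 23 is just large enough for K = 5.95 L v, ln 7 is not. The unknown
  r enters twice: |r| < p / 2 bounds |z| by p (R + S / 2), and r nonzero modulo p makes the
  abscissae z distinct.\<close>

text \<open>
  \<open>cheb_bound \<mu> N \<theta> f a\<close> bounds a weighted coefficient norm of \<open>f\<close> by \<open>a\<close>: Chebyshev polynomials in
  \<open>cos \<theta>\<close> have weight \<open>cosh (n \<mu>)\<close>, and arbitrary functions bounded by 1, which absorb error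
  terms, have weight \<open>exp (N \<mu>)\<close>. A nonzero determinant needs distinct Chebyshev degrees, so the
  weights gain the factor \<open>exp (\<mu> N (N - 1) / 2)\<close> over the trivial estimate.
\<close>

inductive cheb_bound :: "real \<Rightarrow> nat \<Rightarrow> (nat \<Rightarrow> real) \<Rightarrow> (nat \<Rightarrow> real) \<Rightarrow> real \<Rightarrow> bool"
  for \<mu> :: real and N :: nat and \<theta> :: "nat \<Rightarrow> real" where
  cos: "cheb_bound \<mu> N \<theta> (\<lambda>t. cos (real n * \<theta> t)) (cosh (real n * \<mu>))"
| err: "(\<And>t. t < N \<Longrightarrow> \<bar>f t\<bar> \<le> 1) \<Longrightarrow> cheb_bound \<mu> N \<theta> f (exp (real N * \<mu>))"
| add: "cheb_bound \<mu> N \<theta> f a \<Longrightarrow> cheb_bound \<mu> N \<theta> g b \<Longrightarrow> cheb_bound \<mu> N \<theta> (\<lambda>t. f t + g t) (a + b)"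
| scale: "cheb_bound \<mu> N \<theta> f a \<Longrightarrow> cheb_bound \<mu> N \<theta> (\<lambda>t. s * f t) (\<bar>s\<bar> * a)"
| weaken: "cheb_bound \<mu> N \<theta> f a \<Longrightarrow> a \<le> b \<Longrightarrow> cheb_bound \<mu> N \<theta> f b"

lemma cheb_bound_nonneg: "cheb_bound \<mu> N \<theta> f a \<Longrightarrow> 0 \<le> a"
  by (induction rule: cheb_bound.induct) auto

text \<open>Rows are functions, so that replacing one row is a function update
  \<open>F(m := f)\<close> and multilinearity can be stated for functions instead of
  matrices.\<close>

definition fdet :: "nat \<Rightarrow> (nat \<Rightarrow> nat \<Rightarrow> 'a :: comm_ring_1) \<Rightarrow> 'a" where
  "fdet N F = det (mat N N (\<lambda>(c, t). F c t))"

lemma fdet_eq: "fdet N F = (\<Sum>p | p permutes {0..<N}. signof p * (\<Prod>c = 0..<N. F c (p c)))"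
proof -
  have "p c < N" if "p permutes {0..<N}" "c < N" for p c
    using that permutes_in_image[OF that(1)] by auto
  then show ?thesis unfolding fdet_def by (subst det_def'[of _ N]) (auto intro!: sum.cong prod.cong)
qed

lemma fdet_cong: "(\<And>c t. c < N \<Longrightarrow> t < N \<Longrightarrow> F c t = G c t) \<Longrightarrow> fdet N F = fdet N G"
  unfolding fdet_def by (intro arg_cong[of _ _ det]) auto

lemma fdet_identical:
  assumes "i < N" "j < N" "i \<noteq> j" "F i = F j"
  shows "fdet N F = 0"
  unfolding fdet_def
  by (rule det_identical_rows[of _ N i j]) (use assms in \<open>auto intro!: eq_vecI\<close>)

lemma fdet_row:
  fixes F :: "nat \<Rightarrow> nat \<Rightarrow> 'a :: comm_ring_1"
  assumes "m < N"
  shows "fdet N (F(m := f)) = (\<Sum>p | p permutes {0..<N}. f (p m) * (signof p * (\<Prod>c \<in> {0..<N} - {m}. F c (p c))))"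
proof -
  have "(\<Prod>c = 0..<N. (F(m := f)) c (p c)) = f (p m) * (\<Prod>c \<in> {0..<N} - {m}. F c (p c))" for p
    using assms by (subst prod.remove[of _ m]) (auto intro!: prod.cong)
  then show ?thesis unfolding fdet_eq by (simp add: mult_ac)
qed

lemma fdet_row_add:
  fixes F :: "nat \<Rightarrow> nat \<Rightarrow> 'a :: comm_ring_1"
  assumes "m < N"
  shows "fdet N (F(m := (\<lambda>t. f t + g t))) = fdet N (F(m := f)) + fdet N (F(m := g))"
  unfolding fdet_row[OF assms] by (simp add: distrib_right sum.distrib)

lemma fdet_row_scale:
  fixes F :: "nat \<Rightarrow> nat \<Rightarrow> 'a :: comm_ring_1"
  assumes "m < N"
  shows "fdet N (F(m := (\<lambda>t. s * f t))) = s * fdet N (F(m := f))"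
  unfolding fdet_row[OF assms] by (simp add: sum_distrib_left mult_ac)

lemma abs_fdet_le:
  fixes F :: "nat \<Rightarrow> nat \<Rightarrow> real"
  assumes "\<And>c t. c < N \<Longrightarrow> t < N \<Longrightarrow> \<bar>F c t\<bar> \<le> 1"
  shows "\<bar>fdet N F\<bar> \<le> fact N"
proof -
  have "\<bar>signof p * (\<Prod>c = 0..<N. F c (p c))\<bar> \<le> 1" if "p permutes {0..<N}" for p
  proof -
    have "\<bar>\<Prod>c = 0..<N. F c (p c)\<bar> \<le> 1"
      unfolding abs_prod using assms permutes_in_image[OF that] by (intro prod_le_1) auto
    then show ?thesis by (simp add: sign_def abs_mult)
  qed
  then have "\<bar>fdet N F\<bar> \<le> (\<Sum>p | p permutes {0..<N}. 1)"
    unfolding fdet_eq by (intro order.trans[OF sum_abs] sum_mono) auto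
  also have "\<dots> = fact N" by (simp add: card_permutations[of _ N])
  finally show ?thesis .
qed

text \<open>The generators \<open>cos\<close> and \<open>err\<close> of \<open>cheb_bound\<close>,
  to which multilinearity reduces every row.\<close>

definition cheb_atom :: "real \<Rightarrow> nat \<Rightarrow> (nat \<Rightarrow> real) \<Rightarrow> (nat \<Rightarrow> real) \<Rightarrow> real \<Rightarrow> bool" where
  "cheb_atom \<mu> N \<theta> f a \<longleftrightarrow> (\<exists>n. f = (\<lambda>t. cos (real n * \<theta> t)) \<and> a = cosh (real n * \<mu>)) \<or>
     ((\<forall>t<N. \<bar>f t\<bar> \<le> 1) \<and> a = exp (real N * \<mu>))"

lemma sum_distinct_ge:
  fixes S :: "nat set"
  assumes "finite S"
  shows "card S * (card S - 1) \<le> 2 * \<Sum>S"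
  using assms
proof (induction "card S" arbitrary: S)
  case (Suc k)
  then have ne: "S \<noteq> {}" by auto
  let ?m = "Max S"
  have m: "?m \<in> S" using Suc ne by simp
  have k: "card (S - {?m}) = k" using Suc m by simp
  have IH: "k * (k - 1) \<le> 2 * \<Sum>(S - {?m})" using Suc(1)[of "S - {?m}"] Suc k by simp
  have "S \<subseteq> {0..?m}" using Suc(3) by auto
  then have "card S \<le> ?m + 1" using card_mono[of "{0..?m}" S] by simp
  then have "k \<le> ?m" using Suc by simp
  moreover have "\<Sum>S = ?m + \<Sum>(S - {?m})" using m Suc(3) by (simp add: sum.remove)
  moreover have "Suc k * k = k * (k - 1) + 2 * k" by (cases k) auto
  ultimately show ?case using IH Suc(2) by (metis Suc_diff_1 add_mono diff_Suc_1 distrib_left mult_le_mono2 add.commute)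
qed simp

text \<open>Two cosine rows of equal degree coincide and kill the determinant. Otherwise q cosine
  rows have degrees of sum at least q (q - 1) / 2, and each of the other N - q rows counts as degree
  N. The factor \<open>2 ^ N\<close> pays for exp x <= 2 cosh x.\<close>

lemma fdet_atoms:
  assumes \<mu>: "\<mu> \<ge> 0" and at: "\<And>c. c < N \<Longrightarrow> cheb_atom \<mu> N \<theta> (F c) (b c)"
  shows "\<bar>fdet N F\<bar> * exp (\<mu> * (real N * (real N - 1) / 2)) \<le> fact N * 2 ^ N * (\<Prod>c<N. b c)"
proof -
  define Q where "Q = {c. c < N \<and> (\<exists>n. F c = (\<lambda>t. cos (real n * \<theta> t)) \<and> b c = cosh (real n * \<mu>))}"
  define e where "e c = (SOME n. F c = (\<lambda>t. cos (real n * \<theta> t)) \<and> b c = cosh (real n * \<mu>))" for c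
  have e: "F c = (\<lambda>t. cos (real (e c) * \<theta> t))" "b c = cosh (real (e c) * \<mu>)" if "c \<in> Q" for c
    using someI_ex[of "\<lambda>n. F c = (\<lambda>t. cos (real n * \<theta> t)) \<and> b c = cosh (real n * \<mu>)"] that
    unfolding Q_def e_def by auto
  have nQ: "b c = exp (real N * \<mu>)" "\<forall>t<N. \<bar>F c t\<bar> \<le> 1" if "c < N" "c \<notin> Q" for c
    using at[OF that(1)] that unfolding cheb_atom_def Q_def by auto
  have Qsub: "Q \<subseteq> {..<N}" and fQ: "finite Q" unfolding Q_def by auto
  have bpos: "b c > 0" if "c < N" for c
    using at[OF that] unfolding cheb_atom_def by auto
  then have P0: "(\<Prod>c<N. b c) \<ge> 0" by (intro prod_nonneg) (auto intro: less_imp_le)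
  show ?thesis
  proof (cases "inj_on e Q")
    case False
    then obtain c d where cd: "c \<in> Q" "d \<in> Q" "c \<noteq> d" "e c = e d" unfolding inj_on_def by auto
    then have "F c = F d" using e(1) by metis
    then have "fdet N F = 0" using fdet_identical[of c N d F] cd Qsub by auto
    then show ?thesis using P0 by simp
  next
    case True
    let ?q = "card Q"
    have qN: "?q \<le> N" using card_mono[OF _ Qsub] by simp
    have "?q * (?q - 1) \<le> 2 * \<Sum>(e ` Q)" using sum_distinct_ge[of "e ` Q"] fQ True by (simp add: card_image)
    then have s: "?q * (?q - 1) \<le> 2 * (\<Sum>c\<in>Q. e c)" using True by (simp add: sum.reindex)
    have s': "real ?q * (real ?q - 1) \<le> 2 * real (\<Sum>c\<in>Q. e c)"
    proof (cases "?q = 0")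
      case True then show ?thesis by (simp add: sum_nonneg)
    next
      case False
      then have "real ?q * (real ?q - 1) = real (?q * (?q - 1))" by (simp add: of_nat_diff)
      also have "\<dots> \<le> real (2 * (\<Sum>c\<in>Q. e c))" using s by (rule of_nat_mono)
      finally show ?thesis by simp
    qed
    have "\<bar>F c t\<bar> \<le> 1" if "c < N" "t < N" for c t
      using e(1)[of c] nQ(2)[of c] that by (cases "c \<in> Q") auto
    then have d: "\<bar>fdet N F\<bar> \<le> fact N" by (rule abs_fdet_le)
    have "exp (\<mu> * (real N * (real N - 1) / 2)) \<le> exp (\<mu> * (real (\<Sum>c\<in>Q. e c) + real N * (real N - real ?q)))"
    proof -
      \<comment> \<open>Twice the difference of the sides of the next inequality when the degree sum
        is as small as q (q - 1) / 2.\<close>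
      have "0 \<le> (real N - real ?q)\<^sup>2 + (real N - real ?q)" using qN by simp
      then have "real N * (real N - 1) / 2 \<le> real (\<Sum>c\<in>Q. e c) + real N * (real N - real ?q)"
        using s' by (simp add: power2_eq_square field_simps)
      then show ?thesis unfolding exp_le_cancel_iff using \<mu> by (rule mult_left_mono)
    qed
    also have "\<dots> = (\<Prod>c\<in>Q. exp (real (e c) * \<mu>)) * (\<Prod>c\<in>{..<N} - Q. exp (real N * \<mu>))"
    proof -
      have "card ({..<N} - Q) = N - ?q" using Qsub fQ by (simp add: card_Diff_subset)
      then show ?thesis using qN fQ
        by (simp add: exp_sum[symmetric] exp_of_nat_mult[symmetric] exp_add[symmetric] of_nat_diff sum_distrib_left algebra_simps)
    qed
    also have "\<dots> \<le> (\<Prod>c\<in>Q. 2 * b c) * (\<Prod>c\<in>{..<N} - Q. 2 * b c)"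
    proof (intro mult_mono prod_mono conjI)
      fix c assume c: "c \<in> Q"
      have "exp (real (e c) * \<mu>) \<le> 2 * cosh (real (e c) * \<mu>)" by (simp add: cosh_def)
      then show "exp (real (e c) * \<mu>) \<le> 2 * b c" using e(2)[OF c] by simp
    next
      fix c assume "c \<in> {..<N} - Q"
      then show "exp (real N * \<mu>) \<le> 2 * b c" using nQ(1)[of c] by simp
    qed (use bpos Qsub in \<open>auto intro!: prod_nonneg simp: less_imp_le subset_iff\<close>)
    also have "\<dots> = (\<Prod>c<N. 2 * b c)" using Qsub by (metis finite_lessThan mult.commute prod.subset_diff)
    also have "\<dots> = 2 ^ N * (\<Prod>c<N. b c)" by (simp add: prod.distrib)
    finally have "exp (\<mu> * (real N * (real N - 1) / 2)) \<le> 2 ^ N * (\<Prod>c<N. b c)" .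
    from mult_mono[OF d this] show ?thesis by (simp add: mult_ac)
  qed
qed

text \<open>Rows are resolved into atoms one at a time. For row \<open>m\<close> an inner induction
  follows the derivation of \<open>cheb_bound\<close>: the determinant is linear in that row, and
  the weights add and scale accordingly.\<close>

lemma fdet_cheb_bound:
  assumes \<mu>: "\<mu> \<ge> 0" and b: "\<And>c. c < N \<Longrightarrow> cheb_bound \<mu> N \<theta> (F c) (b c)"
  shows "\<bar>fdet N F\<bar> * exp (\<mu> * (real N * (real N - 1) / 2)) \<le> fact N * 2 ^ N * (\<Prod>c<N. b c)"
proof -
  let ?E = "exp (\<mu> * (real N * (real N - 1) / 2))"
  have "m \<le> N \<Longrightarrow> (\<And>c. c < m \<Longrightarrow> cheb_bound \<mu> N \<theta> (F c) (b c)) \<Longrightarrow>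
    (\<And>c. m \<le> c \<Longrightarrow> c < N \<Longrightarrow> cheb_atom \<mu> N \<theta> (F c) (b c)) \<Longrightarrow>
    \<bar>fdet N F\<bar> * ?E \<le> fact N * 2 ^ N * (\<Prod>c<N. b c)" for m F b
  proof (induction m arbitrary: F b)
    case 0
    then show ?case using fdet_atoms[OF \<mu>, of N \<theta> F b] by simp
  next
    case (Suc m)
    then have m: "m < N" by simp
    have nn: "(\<Prod>c\<in>{..<N} - {m}. b c) \<ge> 0"
    proof (intro prod_nonneg)
      fix c assume c: "c \<in> {..<N} - {m}"
      show "0 \<le> b c"
      proof (cases "c < m")
        case True then show ?thesis using Suc(3)[of c] cheb_bound_nonneg by simp
      next
        case False then show ?thesis using Suc(4)[of c] c unfolding cheb_atom_def by auto
      qed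
    qed
    let ?C = "fact N * 2 ^ N * (\<Prod>c\<in>{..<N} - {m}. b c)"
    have C0: "?C \<ge> 0" using nn by simp
    have atom: "\<bar>fdet N (F(m := f))\<bar> * ?E \<le> ?C * a" if "cheb_atom \<mu> N \<theta> f a" for f a
    proof -
      have "\<bar>fdet N (F(m := f))\<bar> * ?E \<le> fact N * 2 ^ N * (\<Prod>c<N. (b(m := a)) c)"
        using Suc.prems that m by (intro Suc.IH) auto
      also have "(\<Prod>c<N. (b(m := a)) c) = a * (\<Prod>c\<in>{..<N} - {m}. b c)"
        using m by (subst prod.remove[of _ m]) (auto intro!: prod.cong)
      finally show ?thesis by (simp add: mult_ac fun_upd_def)
    qed
    have "cheb_bound \<mu> N \<theta> f a \<Longrightarrow> \<bar>fdet N (F(m := f))\<bar> * ?E \<le> ?C * a" for f a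
    proof (induction rule: cheb_bound.induct)
      case (cos n) show ?case by (rule atom) (auto simp: cheb_atom_def)
    next
      case (err f) then show ?case by (intro atom) (auto simp: cheb_atom_def)
    next
      case (add f a g b')
      have "\<bar>fdet N (F(m := f)) + fdet N (F(m := g))\<bar> * ?E \<le>
        \<bar>fdet N (F(m := f))\<bar> * ?E + \<bar>fdet N (F(m := g))\<bar> * ?E"
        unfolding distrib_right[symmetric] by (intro mult_right_mono) auto
      then show ?case unfolding fdet_row_add[OF m] distrib_left using add by linarith
    next
      case (scale f a s)
      have "\<bar>s\<bar> * (\<bar>fdet N (F(m := f))\<bar> * ?E) \<le> \<bar>s\<bar> * (?C * a)"
        by (rule mult_left_mono[OF scale.IH abs_ge_zero])
      then show ?case unfolding fdet_row_scale[OF m] by (simp add: abs_mult mult_ac fun_upd_def)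
    next
      case (weaken f a b')
      then show ?case using mult_left_mono[OF weaken(2) C0] by linarith
    qed
    from this[OF Suc(3)[of m]] have "\<bar>fdet N F\<bar> * ?E \<le> ?C * b m" by simp
    also have "?C * b m = fact N * 2 ^ N * (\<Prod>c<N. b c)"
      using m by (subst prod.remove[of "{..<N}" m]) (auto simp: mult_ac)
    finally show ?case .
  qed
  from this[of N F b] b show ?thesis by simp
qed

text \<open>cosh obeys the same product formula as cos, so multiplying by the variable
  \<open>Z * cos (\<theta> t)\<close> costs exactly \<open>Z * cosh \<mu>\<close>.\<close>

lemma cheb_bound_mult_arg:
  assumes Z: "Z \<ge> 0" and b: "cheb_bound \<mu> N \<theta> f a"
  shows "cheb_bound \<mu> N \<theta> (\<lambda>t. Z * cos (\<theta> t) * f t) (Z * cosh \<mu> * a)"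
  using b
proof (induction rule: cheb_bound.induct)
  case (cos n)
  show ?case
  proof (cases n)
    case 0
    have "cheb_bound \<mu> N \<theta> (\<lambda>t. Z * cos (real 1 * \<theta> t)) (\<bar>Z\<bar> * cosh (real 1 * \<mu>))"
      by (intro cheb_bound.scale cheb_bound.cos)
    then show ?thesis using 0 Z by simp
  next
    case (Suc m)
    have 1: "Z * cos (\<theta> t) * cos (real n * \<theta> t) = Z / 2 * cos (real (Suc n) * \<theta> t) + Z / 2 * cos (real m * \<theta> t)" for t
    proof -
      have "cos (real (Suc n) * \<theta> t) = cos (real n * \<theta> t + \<theta> t)" "cos (real m * \<theta> t) = cos (real n * \<theta> t - \<theta> t)"
        using Suc by (simp_all add: algebra_simps)
      then show ?thesis by (simp add: cos_add cos_diff algebra_simps)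
    qed
    have 2: "Z * cosh \<mu> * cosh (real n * \<mu>) = \<bar>Z / 2\<bar> * cosh (real (Suc n) * \<mu>) + \<bar>Z / 2\<bar> * cosh (real m * \<mu>)"
    proof -
      have "cosh (real (Suc n) * \<mu>) = cosh (real n * \<mu> + \<mu>)" "cosh (real m * \<mu>) = cosh (real n * \<mu> - \<mu>)"
        using Suc by (simp_all add: algebra_simps)
      then show ?thesis unfolding cosh_add cosh_diff using Z by (simp only:) (simp add: field_simps)
    qed
    show ?thesis unfolding 1 2 by (intro cheb_bound.add cheb_bound.scale cheb_bound.cos)
  qed
next
  case (err f)
  have "cheb_bound \<mu> N \<theta> (\<lambda>t. Z * (cos (\<theta> t) * f t)) (\<bar>Z\<bar> * exp (real N * \<mu>))"
  proof (intro cheb_bound.scale cheb_bound.err)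
    fix t assume "t < N"
    then show "\<bar>cos (\<theta> t) * f t\<bar> \<le> 1" using err mult_mono[of "\<bar>cos (\<theta> t)\<bar>" 1 "\<bar>f t\<bar>" 1] by (simp add: abs_mult)
  qed
  moreover have "\<bar>Z\<bar> * exp (real N * \<mu>) \<le> Z * cosh \<mu> * exp (real N * \<mu>)"
    using Z mult_left_mono[OF cosh_real_ge_1[of \<mu>] Z] by (intro mult_right_mono) auto
  ultimately show ?case using cheb_bound.weaken unfolding mult.assoc by blast
next
  case (add f a g b)
  from cheb_bound.add[OF add(3,4)] show ?case by (simp add: distrib_left)
next
  case (scale f a s)
  from cheb_bound.scale[OF scale(2), of s] show ?case by (simp add: mult_ac)
next
  case (weaken f a b)
  have "Z * cosh \<mu> * a \<le> Z * cosh \<mu> * b" using weaken Z by (intro mult_left_mono) auto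
  then show ?case using weaken cheb_bound.weaken by blast
qed

lemma cheb_bound_falling:
  assumes Z: "Z \<ge> 0" and b: "cheb_bound \<mu> N \<theta> f a" and k: "k \<le> K"
  shows "cheb_bound \<mu> N \<theta> (\<lambda>t. (\<Prod>m<k. Z * cos (\<theta> t) - real m) * f t) ((Z * cosh \<mu> + real K) ^ k * a)"
  using k
proof (induction k)
  case 0
  then show ?case using b by simp
next
  case (Suc k)
  let ?g = "\<lambda>t. (\<Prod>m<k. Z * cos (\<theta> t) - real m) * f t"
  let ?a = "(Z * cosh \<mu> + real K) ^ k * a"
  have g: "cheb_bound \<mu> N \<theta> ?g ?a" using Suc by simp
  have a: "?a \<ge> 0" using cheb_bound_nonneg[OF g] .
  have "cheb_bound \<mu> N \<theta> (\<lambda>t. Z * cos (\<theta> t) * ?g t + (- real k) * ?g t) (Z * cosh \<mu> * ?a + \<bar>- real k\<bar> * ?a)"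
    by (intro cheb_bound.add cheb_bound.scale cheb_bound_mult_arg Z g)
  moreover have "Z * cosh \<mu> * ?a + \<bar>- real k\<bar> * ?a \<le> (Z * cosh \<mu> + real K) ^ Suc k * a"
    using Suc.prems mult_right_mono[of "real k" "real K", OF _ a] by (simp add: algebra_simps)
  moreover have "(\<lambda>t. Z * cos (\<theta> t) * ?g t + (- real k) * ?g t) = (\<lambda>t. (\<Prod>m<Suc k. Z * cos (\<theta> t) - real m) * f t)"
    by (auto simp: algebra_simps)
  ultimately show ?case by (simp only: cheb_bound.weaken)
qed

text \<open>A partial sum of the exponential series has weight at most that of its positive
  majorant. The truncation error and the perturbation \<open>\<delta>\<close> are tiny at the N
  points, so together they form a single \<open>err\<close> term.\<close>

lemma cheb_bound_exp:
  assumes Z: "Z \<ge> 0" and N: "N > 0" and \<delta>: "\<And>t. t < N \<Longrightarrow> \<bar>\<delta> t\<bar> \<le> d"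
    and d: "4 * d * real N * exp (real N * \<mu>) \<le> 1" and \<mu>: "\<mu> \<ge> 0"
  shows "cheb_bound \<mu> N \<theta> (\<lambda>t. exp (a * (Z * cos (\<theta> t)) + \<delta> t)) (exp (\<bar>a\<bar> * (Z * cosh \<mu>)) * (1 + 1 / real N))"
proof -
  define x where "x t = a * (Z * cos (\<theta> t))" for t
  define P where "P m t = (\<Sum>n<m. x t ^ n /\<^sub>R fact n)" for m t
  define B where "B = exp (\<bar>a\<bar> * (Z * cosh \<mu>))"
  \<comment> \<open>An \<open>err\<close> term scaled by \<open>\<eta>\<close> has weight B / N.
    This yields the factor \<open>1 + 1 / real N\<close>, which over all N rows costs at most
    e.\<close>
  define \<eta> where "\<eta> = B * exp (- (real N * \<mu>)) / real N"
  have \<eta>0: "\<eta> > 0" using N by (simp add: \<eta>_def B_def)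
  have pw: "cheb_bound \<mu> N \<theta> (\<lambda>t. x t ^ n) ((\<bar>a\<bar> * (Z * cosh \<mu>)) ^ n)" for n
  proof (induction n)
    case 0
    then show ?case using cheb_bound.cos[of \<mu> N \<theta> 0] by simp
  next
    case (Suc n)
    have "cheb_bound \<mu> N \<theta> (\<lambda>t. a * (Z * cos (\<theta> t) * x t ^ n)) (\<bar>a\<bar> * (Z * cosh \<mu> * (\<bar>a\<bar> * (Z * cosh \<mu>)) ^ n))"
      by (intro cheb_bound.scale cheb_bound_mult_arg Z Suc)
    then show ?case by (simp add: x_def mult_ac)
  qed
  have P: "cheb_bound \<mu> N \<theta> (P m) (\<Sum>n<m. (\<bar>a\<bar> * (Z * cosh \<mu>)) ^ n /\<^sub>R fact n)" for m
  proof (induction m)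
    case 0
    have "cheb_bound \<mu> N \<theta> (\<lambda>t. 0 * cos (real 0 * \<theta> t)) (\<bar>0\<bar> * cosh (real 0 * \<mu>))"
      by (intro cheb_bound.scale cheb_bound.cos)
    then show ?case by (simp add: P_def)
  next
    case (Suc m)
    have "cheb_bound \<mu> N \<theta> (\<lambda>t. P m t + inverse (fact m) * x t ^ m) ((\<Sum>n<m. (\<bar>a\<bar> * (Z * cosh \<mu>)) ^ n /\<^sub>R fact n) + \<bar>inverse (fact m)\<bar> * (\<bar>a\<bar> * (Z * cosh \<mu>)) ^ m)"
      by (intro cheb_bound.add cheb_bound.scale pw Suc)
    then show ?case by (simp add: P_def)
  qed
  have PB: "cheb_bound \<mu> N \<theta> (P m) B" for m
  proof (rule cheb_bound.weaken[OF P])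
    show "(\<Sum>n<m. (\<bar>a\<bar> * (Z * cosh \<mu>)) ^ n /\<^sub>R fact n) \<le> B"
      unfolding B_def exp_def using Z
      by (intro sum_le_suminf summable_exp_generic) (auto intro!: mult_nonneg_nonneg)
  qed
  have "\<forall>\<^sub>F m in sequentially. \<forall>t\<in>{..<N}. \<bar>exp (x t) - P m t\<bar> < \<eta> / 2"
  proof (intro eventually_ball_finite ballI)
    fix t
    have "(\<lambda>m. P m t) \<longlonglongrightarrow> exp (x t)" unfolding P_def
      using summable_exp_generic[of "x t"] summable_LIMSEQ exp_def by metis
    then have "\<forall>\<^sub>F m in sequentially. dist (P m t) (exp (x t)) < \<eta> / 2"
      using \<eta>0 by (intro tendstoD) auto
    then show "\<forall>\<^sub>F m in sequentially. \<bar>exp (x t) - P m t\<bar> < \<eta> / 2"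
      by (simp add: dist_real_def abs_minus_commute)
  qed simp
  then obtain m where m: "\<And>t. t < N \<Longrightarrow> \<bar>exp (x t) - P m t\<bar> < \<eta> / 2"
    by (auto simp: eventually_sequentially)
  have dN: "d \<le> 1 / (4 * real N * exp (real N * \<mu>))" using d N by (simp add: field_simps)
  have err: "\<bar>exp (x t + \<delta> t) - P m t\<bar> \<le> \<eta>" if t: "t < N" for t
  proof -
    have "1 / (4 * real N * exp (real N * \<mu>)) \<le> 1"
    proof -
      have "1 * 1 \<le> real N * exp (real N * \<mu>)" using N \<mu> by (intro mult_mono) auto
      then show ?thesis by (simp add: field_simps)
    qed
    then have "\<bar>\<delta> t\<bar> \<le> 1" using \<delta>[OF t] dN by linarith
    then have "\<bar>exp (\<delta> t) - 1\<bar> \<le> 2 * \<bar>\<delta> t\<bar>"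
    proof (cases "\<delta> t \<ge> 0")
      case True
      then show ?thesis using exp_bound[of "\<delta> t"] \<open>\<bar>\<delta> t\<bar> \<le> 1\<close> mult_left_mono[of "\<delta> t" 1 "\<delta> t"]
        by (simp add: power2_eq_square)
    next
      case False
      then have "exp (\<delta> t) \<le> 1" by simp
      then show ?thesis using exp_ge_add_one_self[of "\<delta> t"] False by linarith
    qed
    then have "\<bar>exp (\<delta> t) - 1\<bar> \<le> 2 * d" using \<delta>[OF t] by linarith
    moreover have "exp (x t) \<le> B"
    proof -
      have "x t \<le> \<bar>a\<bar> * (Z * 1)" unfolding x_def
      proof -
        have "a * (Z * cos (\<theta> t)) \<le> \<bar>a\<bar> * (Z * \<bar>cos (\<theta> t)\<bar>)" using Z
          by (metis abs_ge_self abs_mult abs_of_nonneg)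
        also have "\<dots> \<le> \<bar>a\<bar> * (Z * 1)" using Z by (intro mult_left_mono) auto
        finally show "a * (Z * cos (\<theta> t)) \<le> \<bar>a\<bar> * (Z * 1)" .
      qed
      also have "\<dots> \<le> \<bar>a\<bar> * (Z * cosh \<mu>)" using Z cosh_real_ge_1 by (intro mult_left_mono) auto
      finally show ?thesis by (simp add: B_def)
    qed
    ultimately have "exp (x t) * \<bar>exp (\<delta> t) - 1\<bar> \<le> B * (2 * d)" by (intro mult_mono) (auto simp: B_def)
    also have "\<dots> \<le> B * (2 * (1 / (4 * real N * exp (real N * \<mu>))))" using dN by (intro mult_left_mono) (auto simp: B_def)
    also have "\<dots> = \<eta> / 2" by (simp add: \<eta>_def exp_minus field_simps)
    finally have "\<bar>exp (x t) * (exp (\<delta> t) - 1)\<bar> \<le> \<eta> / 2" by (simp add: abs_mult)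
    moreover have "exp (x t + \<delta> t) - exp (x t) = exp (x t) * (exp (\<delta> t) - 1)"
      by (simp add: exp_add algebra_simps)
    ultimately have "\<bar>exp (x t + \<delta> t) - exp (x t)\<bar> \<le> \<eta> / 2" by simp
    then show ?thesis using m[OF t] by linarith
  qed
  have "cheb_bound \<mu> N \<theta> (\<lambda>t. P m t + \<eta> * ((exp (x t + \<delta> t) - P m t) / \<eta>)) (B + \<bar>\<eta>\<bar> * exp (real N * \<mu>))"
    using err \<eta>0 by (intro cheb_bound.add cheb_bound.scale cheb_bound.err PB) auto
  moreover have "B + \<bar>\<eta>\<bar> * exp (real N * \<mu>) = B * (1 + 1 / real N)"
    using \<eta>0 N by (simp add: \<eta>_def exp_minus field_simps)
  ultimately show ?thesis using \<eta>0 by (simp add: x_def B_def)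
qed

subsection \<open>The zero estimate\<close>

text \<open>Points are chosen greedily. Expansion along the last column gives a combination of the
  functions at the new point; the coefficient of \<open>g m\<close> is the previous, nonzero minor,
  so independence on \<open>E\<close> supplies a point where the combination does not
  vanish.\<close>

lemma exists_points_fdet_nonzero:
  fixes g :: "nat \<Rightarrow> 'b \<Rightarrow> real"
  assumes indep: "\<And>a. (\<And>e. e \<in> E \<Longrightarrow> (\<Sum>c<N. a c * g c e) = 0) \<Longrightarrow> (\<And>c. c < N \<Longrightarrow> a c = 0)"
  shows "\<exists>pts. (\<forall>t<N. pts t \<in> E) \<and> fdet N (\<lambda>c t. g c (pts t)) \<noteq> 0"
proof -
  have "m \<le> N \<Longrightarrow> \<exists>pts. (\<forall>t<m. pts t \<in> E) \<and> fdet m (\<lambda>c t. g c (pts t)) \<noteq> 0" for m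
  proof (induction m)
    case 0
    then show ?case by (auto simp: fdet_def)
  next
    case (Suc m)
    then obtain pts where pts: "\<And>t. t < m \<Longrightarrow> pts t \<in> E" "fdet m (\<lambda>c t. g c (pts t)) \<noteq> 0" by auto
    let ?A = "\<lambda>pts. mat (Suc m) (Suc m) (\<lambda>(c, t). g c (pts t))"
    define cof where "cof c = cofactor (?A pts) c m" for c
    have exp: "fdet (Suc m) (\<lambda>c t. g c ((pts(m := e)) t)) = (\<Sum>c<Suc m. cof c * g c e)" for e
    proof -
      have "mat_delete (?A (pts(m := e))) c m = mat_delete (?A pts) c m" if "c < Suc m" for c
        unfolding mat_delete_def by (intro eq_matI) auto
      then have "cofactor (?A (pts(m := e))) c m = cof c" if "c < Suc m" for c
        using that unfolding cof_def cofactor_def by simp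
      then show ?thesis unfolding fdet_def
        by (subst laplace_expansion_column[of _ "Suc m" m]) (auto intro!: sum.cong simp: mult.commute)
    qed
    have "mat_delete (?A pts) m m = mat m m (\<lambda>(c, t). g c (pts t))"
      unfolding mat_delete_def by (intro eq_matI) auto
    then have cofm: "cof m \<noteq> 0" using pts(2) unfolding cof_def cofactor_def fdet_def by simp
    have "\<exists>e\<in>E. (\<Sum>c<Suc m. cof c * g c e) \<noteq> 0"
    proof (rule ccontr)
      assume "\<not> ?thesis"
      then have z: "\<And>e. e \<in> E \<Longrightarrow> (\<Sum>c<Suc m. cof c * g c e) = 0" by auto
      define a where "a c = (if c < Suc m then cof c else 0)" for c
      have "(\<Sum>c<N. a c * g c e) = (\<Sum>c<Suc m. cof c * g c e)" for e
        using Suc.prems by (intro sum.mono_neutral_cong_right) (auto simp: a_def)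
      then have "a m = 0" using indep[of a m] z Suc.prems by simp
      then show False using cofm by (simp add: a_def)
    qed
    then obtain e where e: "e \<in> E" "(\<Sum>c<Suc m. cof c * g c e) \<noteq> 0" by auto
    then show ?case using pts(1) exp[of e] by (intro exI[of _ "pts(m := e)"]) (auto simp: less_Suc_eq)
  qed
  then show ?thesis by blast
qed

lemma fdet_transpose: "fdet N F = fdet N (\<lambda>c t. F t c)"
proof -
  have "transpose_mat (mat N N (\<lambda>(c, t). F c t)) = mat N N (\<lambda>(c, t). F t c)" by (intro eq_matI) auto
  then show ?thesis unfolding fdet_def using det_transpose[of "mat N N (\<lambda>(c, t). F c t)" N] by simp
qed

lemma fdet_eq_0_iff:
  fixes F :: "nat \<Rightarrow> nat \<Rightarrow> real"
  shows "fdet m F = 0 \<longleftrightarrow> (\<exists>v. (\<exists>c<m. v c \<noteq> 0) \<and> (\<forall>t<m. (\<Sum>c<m. v c * F c t) = 0))" (is "_ \<longleftrightarrow> ?R")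
proof -
  let ?A = "mat m m (\<lambda>(c, t). F t c)"
  have "fdet m F = det ?A" unfolding fdet_transpose[of m F] unfolding fdet_def ..
  then have "fdet m F = 0 \<longleftrightarrow> (\<exists>v. v \<in> carrier_vec m \<and> v \<noteq> 0\<^sub>v m \<and> ?A *\<^sub>v v = 0\<^sub>v m)"
    using det_0_iff_vec_prod_zero[of ?A m] by simp
  also have "\<dots> \<longleftrightarrow> ?R"
  proof
    assume "\<exists>v. v \<in> carrier_vec m \<and> v \<noteq> 0\<^sub>v m \<and> ?A *\<^sub>v v = 0\<^sub>v m"
    then obtain v where v: "v \<in> carrier_vec m" "v \<noteq> 0\<^sub>v m" "?A *\<^sub>v v = 0\<^sub>v m" by auto
    have "\<exists>c<m. v $ c \<noteq> 0" using v(1,2) by (metis carrier_vecD eq_vecI index_zero_vec(1,2))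
    moreover have "(\<Sum>c<m. v $ c * F c t) = 0" if "t < m" for t
    proof -
      have "(?A *\<^sub>v v) $ t = 0" using v(3) that by simp
      then show ?thesis using v(1) that by (simp add: scalar_prod_def atLeast0LessThan mult.commute)
    qed
    ultimately show ?R by blast
  next
    assume ?R
    then obtain v where v: "\<exists>c<m. v c \<noteq> 0" "\<And>t. t < m \<Longrightarrow> (\<Sum>c<m. v c * F c t) = 0" by auto
    let ?v = "vec m v"
    have "?v \<noteq> 0\<^sub>v m" using v(1) by (metis index_vec index_zero_vec(1))
    moreover have "?A *\<^sub>v ?v = 0\<^sub>v m"
      using v(2) by (intro eq_vecI) (auto simp: scalar_prod_def atLeast0LessThan mult.commute)
    ultimately show "\<exists>v. v \<in> carrier_vec m \<and> v \<noteq> 0\<^sub>v m \<and> ?A *\<^sub>v v = 0\<^sub>v m" by (intro exI[of _ ?v]) auto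
  qed
  finally show ?thesis .
qed

text \<open>A kernel vector would be the coefficient list of a nonzero polynomial of degree below m
  with the m distinct roots \<open>w ^ e t\<close>.\<close>

lemma vandermonde_nonzero:
  fixes w :: real
  assumes w: "w > 1" and e: "inj_on e {..<m}"
  shows "fdet m (\<lambda>q s. w ^ (s * e q)) \<noteq> 0"
proof
  assume "fdet m (\<lambda>q s. w ^ (s * e q)) = 0"
  then have "fdet m (\<lambda>s q. w ^ (s * e q)) = 0" by (subst fdet_transpose)
  then obtain v where v: "\<exists>c<m. v c \<noteq> 0" "\<And>t. t < m \<Longrightarrow> (\<Sum>c<m. v c * w ^ (c * e t)) = 0"
    unfolding fdet_eq_0_iff by auto
  define p where "p = (\<Sum>c<m. monom (v c) c)"
  have cp: "coeff p c = (if c < m then v c else 0)" for c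
    unfolding p_def by (simp add: coeff_sum if_distrib cong: if_cong)
  have "p \<noteq> 0" using v(1) cp by (metis coeff_0)
  have m: "m > 0" using v(1) by auto
  have deg: "degree p < m"
    using m cp by (metis degree_0 \<open>p \<noteq> 0\<close> leading_coeff_neq_0)
  have "poly p (w ^ e t) = 0" if "t < m" for t
    unfolding p_def using v(2)[OF that] by (simp add: poly_sum poly_monom power_mult[symmetric] mult.commute)
  then have "(\<lambda>t. w ^ e t) ` {..<m} \<subseteq> {x. poly p x = 0}" by auto
  then have "card ((\<lambda>t. w ^ e t) ` {..<m}) \<le> card {x. poly p x = 0}"
    using \<open>p \<noteq> 0\<close> by (intro card_mono poly_roots_finite)
  also have "\<dots> \<le> degree p" using \<open>p \<noteq> 0\<close> by (rule card_poly_roots_bound)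
  finally have "card ((\<lambda>t. w ^ e t) ` {..<m}) < m" using deg by simp
  moreover have "inj_on (\<lambda>t. w ^ e t) {..<m}"
    using e w unfolding inj_on_def by (auto simp: power_inject_exp)
  ultimately show False by (simp add: card_image)
qed

text \<open>
  The translates of an exponential polynomial by \<open>s \<nu>\<close> all vanish on \<open>E\<close>, so the determinant of
  their coefficient polynomials vanishes at every abscissa of \<open>E\<close>; its leading coefficient is a
  nonzero Vandermonde determinant.
\<close>

lemma zero_estimate_core:
  fixes P :: "nat \<Rightarrow> real poly" and e :: "nat \<Rightarrow> nat" and w \<nu> :: real and E :: "(real \<times> real) set"
  assumes w: "w > 1" and e: "inj_on e {..<m}" and m: "m > 0"
    and P: "\<And>q. q < m \<Longrightarrow> P q \<noteq> 0" "\<And>q. q < m \<Longrightarrow> degree (P q) \<le> d"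
    and u: "\<And>z u. (z, u) \<in> E \<Longrightarrow> u \<noteq> 0"
    and card: "card (fst ` E) > d * m"
    and van: "\<And>z u s. (z, u) \<in> E \<Longrightarrow> s < m \<Longrightarrow> (\<Sum>q<m. poly (P q) (z + real s * \<nu>) * (w ^ s * u) ^ e q) = 0"
  shows False
proof -
  define G where "G q s = smult (w ^ (s * e q)) (pcompose (P q) [:real s * \<nu>, 1:])" for q s
  define D where "D = fdet m G"
  \<comment> \<open>Translation and scaling preserve degrees, so all terms of the Leibniz expansion
    of \<open>D\<close> have the same degree \<open>\<delta>\<close>, and their top coefficients can
    simply be added.\<close>
  define \<delta> where "\<delta> = (\<Sum>q<m. degree (P q))"
  have degG: "degree (G q s) = degree (P q)" and leadG: "lead_coeff (G q s) = w ^ (s * e q) * lead_coeff (P q)"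
    and G0: "q < m \<Longrightarrow> G q s \<noteq> 0" for q s
  proof -
    show *: "degree (G q s) = degree (P q)" using w by (simp add: G_def degree_pcompose)
    show "lead_coeff (G q s) = w ^ (s * e q) * lead_coeff (P q)"
      unfolding G_def lead_coeff_smult by (subst lead_coeff_comp) auto
    then show "q < m \<Longrightarrow> G q s \<noteq> 0" using P(1)[of q] w
      by (metis leading_coeff_0_iff mult_eq_0_iff power_not_zero not_one_less_zero)
  qed
  have degprod: "degree (\<Prod>q = 0..<m. G q (p q)) = \<delta>" for p
    using G0 degG by (subst degree_prod_eq_sum_degree) (auto simp: \<delta>_def atLeast0LessThan)
  have "coeff D \<delta> = (\<Sum>p | p permutes {0..<m}. signof p * (\<Prod>q = 0..<m. w ^ (p q * e q) * lead_coeff (P q)))"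
  proof -
    have "coeff (signof p * (\<Prod>q = 0..<m. G q (p q))) \<delta> = signof p * (\<Prod>q = 0..<m. w ^ (p q * e q) * lead_coeff (P q))" for p
    proof -
      have "coeff (\<Prod>q = 0..<m. G q (p q)) \<delta> = lead_coeff (\<Prod>q = 0..<m. G q (p q))" using degprod by simp
      also have "\<dots> = (\<Prod>q = 0..<m. w ^ (p q * e q) * lead_coeff (P q))" unfolding lead_coeff_prod leadG ..
      finally show ?thesis by (simp add: sign_def)
    qed
    then show ?thesis unfolding D_def fdet_eq coeff_sum by simp
  qed
  also have "\<dots> = (\<Prod>q = 0..<m. lead_coeff (P q)) * fdet m (\<lambda>q s. w ^ (s * e q))"
    unfolding fdet_eq by (simp add: prod.distrib sum_distrib_left mult_ac)
  finally have "coeff D \<delta> \<noteq> 0" using vandermonde_nonzero[OF w e] P(1) by simp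
  then have D0: "D \<noteq> 0" by auto
  have "degree D \<le> d * m"
  proof -
    have "\<delta> \<le> d * m" unfolding \<delta>_def using P(2) sum_bounded_above[of "{..<m}" "\<lambda>q. degree (P q)" d] by (simp add: mult.commute)
    moreover have "degree D \<le> \<delta>" unfolding D_def fdet_eq
      using degprod by (intro degree_sum_le) (auto simp: sign_def finite_permutations)
    ultimately show ?thesis by simp
  qed
  have "fst ` E \<subseteq> {x. poly D x = 0}"
  proof safe
    fix z u assume zu: "(z, u) \<in> E"
    have "poly D z = fdet m (\<lambda>q s. poly (G q s) z)"
      unfolding D_def fdet_eq by (simp add: poly_sum poly_prod sign_def)
    also have "\<dots> = 0" unfolding fdet_eq_0_iff
    \<comment> \<open>The vanishing of the m translates at (z, u) says that the vector of powers
      \<open>u ^ e q\<close> is a row dependency.\<close>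
    proof (intro exI[of _ "\<lambda>q. u ^ e q"] conjI allI impI)
      show "\<exists>c<m. u ^ e c \<noteq> 0" using m u[OF zu] by auto
      fix s assume s: "s < m"
      show "(\<Sum>c<m. u ^ e c * poly (G c s) z) = 0"
        using van[OF zu s] by (simp add: G_def poly_pcompose power_mult_distrib power_mult[symmetric] add.commute mult_ac)
    qed
    finally show "poly D (fst (z, u)) = 0" by simp
  qed
  then have "card (fst ` E) \<le> card {x. poly D x = 0}" using D0 by (intro card_mono poly_roots_finite)
  also have "\<dots> \<le> degree D" using D0 by (rule card_poly_roots_bound)
  finally show False using card \<open>degree D \<le> d * m\<close> by simp
qed

text \<open>The k-fold product is monic of degree k, so the last nonzero \<open>b k\<close> would
  survive as a coefficient.\<close>

lemma falling_poly_independent: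
  fixes b :: "nat \<Rightarrow> real"
  assumes 0: "(\<Sum>k<K. smult (b k) (\<Prod>m<k. [:- real m, 1:])) = 0" and k: "k < K"
  shows "b k = 0"
proof (rule ccontr)
  assume "b k \<noteq> 0"
  define S where "S = {k. k < K \<and> b k \<noteq> 0}"
  define j where "j = Max S"
  have S: "finite S" "S \<noteq> {}" using \<open>b k \<noteq> 0\<close> k by (auto simp: S_def)
  then have "j \<in> S" unfolding j_def by (rule Max_in)
  have mx: "b i = 0" if "i < K" "i > j" for i
    using Max_ge[OF S(1), of i] that unfolding j_def S_def by fastforce
  let ?f = "\<lambda>k. \<Prod>m<k. [:- real m, 1:]"
  have deg: "degree (?f i) = i" for i by (subst degree_prod_eq_sum_degree) auto
  have lead: "coeff (?f i) i = 1" for i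
  proof -
    have "lead_coeff (?f i) = 1" by (simp add: lead_coeff_prod)
    then show ?thesis by (simp add: deg)
  qed
  have "coeff (\<Sum>k<K. smult (b k) (?f k)) j = (\<Sum>k<K. b k * coeff (?f k) j)" by (simp add: coeff_sum)
  also have "\<dots> = (\<Sum>k\<in>{j}. b k * coeff (?f k) j)"
  proof (intro sum.mono_neutral_right ballI)
    fix i assume i: "i \<in> {..<K} - {j}"
    show "b i * coeff (?f i) j = 0"
    proof (cases "i < j")
      case True then show ?thesis using deg[of i] by (simp add: coeff_eq_0)
    next
      case False then show ?thesis using mx[of i] i by simp
    qed
  qed (use \<open>j \<in> S\<close> in \<open>auto simp: S_def\<close>)
  also have "\<dots> = b j" by (simp add: lead)
  finally show False using 0 \<open>j \<in> S\<close> by (simp add: S_def)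
qed

text \<open>A shift of \<open>i\<close> by s moves \<open>z\<close> by \<open>s * \<nu>\<close> and
  multiplies \<open>u\<close> by \<open>w ^ s\<close>. A combination that vanishes on the grid
  lengthened by L - 1 in the direction of \<open>i\<close> thus provides the translates for
  \<open>zero_estimate_core\<close> on the shorter grid, where \<open>z\<close> takes R S distinct
  values.\<close>

lemma grid_independent:
  fixes \<nu> r w \<gamma> :: real and i0 j0 h :: int and K L R S :: nat and a :: "nat \<Rightarrow> real"
  assumes w: "w > 1" and \<gamma>: "\<gamma> > 0"
  defines "z \<equiv> \<lambda>(i, j). \<nu> * of_int i + r * of_int j"
    and "u \<equiv> \<lambda>(i, j). w powi i * \<gamma> powi j"
  assumes inj: "inj_on z ({i0..<i0 + int R} \<times> {j0..<j0 + int S})"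
    and RS: "R * S > (K - 1) * L"
    and van: "\<And>e. e \<in> {i0..<i0 + int R + int L - 1} \<times> {j0..<j0 + int S} \<Longrightarrow>
      (\<Sum>c<K*L. a c * ((\<Prod>m<c mod K. z e - real m) / fact (c mod K) * u e powi (int (c div K) - h))) = 0"
    and c: "c < K * L"
  shows "a c = 0"
proof -
  let ?E = "{i0..<i0 + int R + int L - 1} \<times> {j0..<j0 + int S}"
  let ?E2 = "{i0..<i0 + int R} \<times> {j0..<j0 + int S}"
  have K: "K > 0" using c by (cases K) auto
  define P where "P l = (\<Sum>k<K. smult (a (l * K + k) / fact k) (\<Prod>m<k. [:- real m, 1:]))" for l
  have upos: "u e > 0" for e using w \<gamma> by (cases e) (simp add: u_def)
  have van': "(\<Sum>l<L. poly (P l) (z e) * u e ^ l) = 0" if e: "e \<in> ?E" for e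
  proof -
    let ?f = "\<lambda>c. a c * ((\<Prod>m<c mod K. z e - real m) / fact (c mod K) * u e powi (int (c div K) - h))"
    have pw: "u e powi (int l - h) = u e ^ l * u e powi (- h)" for l
      using upos[of e] by (simp add: power_int_diff power_int_minus field_simps)
    have "0 = (\<Sum>c<L*K. ?f c)" using van[OF e] by (simp add: mult.commute)
    also have "\<dots> = (\<Sum>l<L. \<Sum>c = l * K..<l * K + K. ?f c)" by (rule sum.nat_group[symmetric])
    also have "\<dots> = (\<Sum>l<L. \<Sum>k<K. ?f (l * K + k))"
      by (rule sum.cong[OF refl], subst sum.atLeastLessThan_shift_0) (simp only: add_diff_cancel_left' atLeast0LessThan comp_def)
    also have "\<dots> = (\<Sum>l<L. poly (P l) (z e) * u e ^ l * u e powi (- h))"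
    proof (intro sum.cong refl)
      fix l
      have "(\<Sum>k<K. ?f (l * K + k)) = (\<Sum>k<K. (a (l * K + k) / fact k * (\<Prod>m<k. z e - real m)) * (u e ^ l * u e powi (- h)))"
        by (intro sum.cong refl) (simp add: pw)
      also have "\<dots> = (\<Sum>k<K. a (l * K + k) / fact k * (\<Prod>m<k. z e - real m)) * (u e ^ l * u e powi (- h))"
        by (rule sum_distrib_right[symmetric])
      finally show "(\<Sum>k<K. ?f (l * K + k)) = poly (P l) (z e) * u e ^ l * u e powi (- h)"
        unfolding P_def by (simp add: poly_sum poly_prod mult.assoc)
    qed
    also have "\<dots> = (\<Sum>l<L. poly (P l) (z e) * u e ^ l) * u e powi (- h)" by (simp add: sum_distrib_right)
    finally show ?thesis using upos[of e] by (simp add: power_int_eq_0_iff)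
  qed
  \<comment> \<open>The core estimate needs nonzero polynomials. Only the m <= L exponents with
    \<open>P l\<close> nonzero are kept, and then m translates suffice.\<close>
  define A where "A = {l. l < L \<and> P l \<noteq> 0}"
  have fA: "finite A" and AL: "card A \<le> L"
    unfolding A_def using card_mono[of "{..<L}" "{l. l < L \<and> P l \<noteq> 0}"] by auto
  have "A = {}"
  proof (rule ccontr)
    assume ne: "A \<noteq> {}"
    define m where "m = card A"
    have m: "m > 0" "m \<le> L" using ne fA AL by (auto simp: m_def card_gt_0_iff)
    obtain e where e: "bij_betw e {..<m} A"
      using ex_bij_betw_nat_finite[OF fA] unfolding m_def atLeast0LessThan by auto
    let ?E' = "(\<lambda>x. (z x, u x)) ` ?E2"
    show False
    proof (rule zero_estimate_core[of w e m "\<lambda>q. P (e q)" "K - 1" ?E' \<nu>])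
      show "inj_on e {..<m}" using e by (rule bij_betw_imp_inj_on)
      have eA: "e q \<in> A" if "q < m" for q using e that by (auto simp: bij_betw_def)
      then show "P (e q) \<noteq> 0" if "q < m" for q using that by (auto simp: A_def)
      show "degree (P (e q)) \<le> K - 1" for q unfolding P_def
      proof (rule degree_sum_le)
        fix k assume "k \<in> {..<K}"
        then show "degree (smult (a (e q * K + k) / fact k) (\<Prod>m<k. [:- real m, 1:])) \<le> K - 1"
          by (intro order.trans[OF degree_smult_le] order.trans[OF degree_prod_sum_le]) auto
      qed simp
      show "u' \<noteq> 0" if "(z', u') \<in> ?E'" for z' u' using that upos by (metis (mono_tags, lifting) imageE less_irrefl prod.inject)
      have "fst ` ?E' = z ` ?E2" by (simp add: image_image)
      then have "card (fst ` ?E') = R * S" using inj by (simp add: card_image)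
      moreover have "(K - 1) * m \<le> (K - 1) * L" using m by simp
      ultimately show "(K - 1) * m < card (fst ` ?E')" using RS by linarith
      show "(\<Sum>q<m. poly (P (e q)) (z' + real s * \<nu>) * (w ^ s * u') ^ e q) = 0" if zu: "(z', u') \<in> ?E'" and s: "s < m" for z' u' s
      proof -
        obtain i j where ij: "(i, j) \<in> ?E2" "z' = z (i, j)" "u' = u (i, j)" using zu by auto
        let ?e = "(i + int s, j)"
        have "?e \<in> ?E" using ij(1) s m by auto
        have "z ?e = z' + real s * \<nu>" using ij(2) by (simp add: z_def algebra_simps)
        moreover have "u ?e = w ^ s * u'" using ij(3) w by (simp add: u_def power_int_add)
        ultimately have "(\<Sum>l<L. poly (P l) (z' + real s * \<nu>) * (w ^ s * u') ^ l) = 0" using van'[OF \<open>?e \<in> ?E\<close>] by simp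
        moreover have "(\<Sum>l<L. poly (P l) (z' + real s * \<nu>) * (w ^ s * u') ^ l) = (\<Sum>l\<in>A. poly (P l) (z' + real s * \<nu>) * (w ^ s * u') ^ l)"
          by (intro sum.mono_neutral_right) (auto simp: A_def)
        ultimately show ?thesis using sum.reindex_bij_betw[OF e, of "\<lambda>l. poly (P l) (z' + real s * \<nu>) * (w ^ s * u') ^ l"] by simp
      qed
    qed (use w m in auto)
  qed
  then have "P (c div K) = 0" using c by (auto simp: A_def less_mult_imp_div_less mult.commute)
  then have "a (c div K * K + c mod K) / fact (c mod K) = 0"
    unfolding P_def by (rule falling_poly_independent) (use K in auto)
  then show ?thesis by simp
qed

subsection \<open>Arithmetic of the ring generated by the square root of 2\<close>

text \<open>Pairs of integers instead of real numbers, so that conjugation is a function.\<close>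

datatype zsqrt2 = Zs (rat_part: int) (irr_part: int)

instantiation zsqrt2 :: comm_ring_1
begin

definition "0 = Zs 0 0"
definition "1 = Zs 1 0"
definition "v + w = Zs (rat_part v + rat_part w) (irr_part v + irr_part w)"
definition "v - w = Zs (rat_part v - rat_part w) (irr_part v - irr_part w)"
definition "- v = Zs (- rat_part v) (- irr_part v)"
definition "v * w = Zs (rat_part v * rat_part w + 2 * irr_part v * irr_part w)
  (rat_part v * irr_part w + irr_part v * rat_part w)"

instance
  by standard (auto simp: zero_zsqrt2_def one_zsqrt2_def plus_zsqrt2_def minus_zsqrt2_def
    uminus_zsqrt2_def times_zsqrt2_def algebra_simps)

end

lemmas zsqrt2_ops = zero_zsqrt2_def one_zsqrt2_def plus_zsqrt2_def minus_zsqrt2_def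
  uminus_zsqrt2_def times_zsqrt2_def

definition zconj :: "zsqrt2 \<Rightarrow> zsqrt2" where "zconj v = Zs (rat_part v) (- irr_part v)"
definition znorm :: "zsqrt2 \<Rightarrow> int" where "znorm v = (rat_part v)\<^sup>2 - 2 * (irr_part v)\<^sup>2"
definition zval :: "zsqrt2 \<Rightarrow> real" where "zval v = of_int (rat_part v) + of_int (irr_part v) * sqrt 2"

lemma zconj_simps [simp]:
  "zconj 1 = 1" "zconj (v * w) = zconj v * zconj w" "zconj (v + w) = zconj v + zconj w"
  "zconj (- v) = - zconj v" "zconj (zconj v) = v" "zconj 0 = 0"
  by (auto simp: zconj_def zsqrt2_ops)

lemma zconj_power [simp]: "zconj (v ^ n) = zconj v ^ n"
  by (induction n) auto

lemma zval_simps [simp]: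
  "zval 1 = 1" "zval (v * w) = zval v * zval w" "zval (v + w) = zval v + zval w"
  "zval (- v) = - zval v" "zval 0 = 0" "zval (Zs a 0) = of_int a"
  by (auto simp: zval_def zsqrt2_ops algebra_simps)

lemma zval_power [simp]: "zval (v ^ n) = zval v ^ n"
  by (induction n) auto

lemma mult_zconj: "v * zconj v = Zs (znorm v) 0"
  by (auto simp: zconj_def znorm_def zsqrt2_ops power2_eq_square)

lemma zval_mult_zconj: "zval v * zval (zconj v) = of_int (znorm v)"
  using mult_zconj[of v] zval_simps(2)[of v "zconj v"] by simp

lemma znorm_mult: "znorm (v * w) = znorm v * znorm w"
  by (auto simp: znorm_def zsqrt2_ops power2_eq_square algebra_simps)

lemma znorm_one [simp]: "znorm 1 = 1" by (simp add: znorm_def one_zsqrt2_def)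

lemma znorm_power: "znorm (v ^ n) = znorm v ^ n"
  by (induction n) (auto simp: znorm_mult)

lemma znorm_eq_0:
  assumes "znorm v = 0"
  shows "v = 0"
proof -
  obtain a b where v: "v = Zs a b" by (cases v)
  have eq: "a\<^sup>2 = 2 * b\<^sup>2" using assms v by (simp add: znorm_def)
  have "b = 0"
  proof (rule ccontr)
    assume b: "b \<noteq> 0"
    then have a: "a \<noteq> 0" using eq by auto
    have "multiplicity 2 (a\<^sup>2) = 2 * multiplicity 2 a"
      using a by (simp add: prime_elem_multiplicity_power_distrib)
    moreover have "multiplicity 2 (2 * b\<^sup>2) = 1 + 2 * multiplicity 2 b"
      using b by (subst prime_elem_multiplicity_mult_distrib) (auto simp: prime_elem_multiplicity_power_distrib)
    ultimately have "2 * multiplicity 2 a = 1 + 2 * multiplicity 2 b" using eq by simp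
    then show False by presburger
  qed
  then show ?thesis using eq v by (simp add: zero_zsqrt2_def)
qed

lemma nearest_multiple: "n \<noteq> 0 \<Longrightarrow> \<exists>q::int. 2 * \<bar>a - q * n\<bar> \<le> \<bar>n\<bar>"
proof -
  assume n: "n \<noteq> 0"
  define q where "q = round (of_int a / of_int n :: real)"
  have "\<bar>of_int q - of_int a / of_int n :: real\<bar> \<le> 1/2" unfolding q_def by (rule of_int_round_abs_le)
  then have "2 * (\<bar>of_int q - of_int a / of_int n\<bar> * \<bar>of_int n\<bar>) \<le> (\<bar>of_int n\<bar>::real)"
    using mult_right_mono[of "\<bar>of_int q - of_int a / of_int n :: real\<bar>" "1/2" "\<bar>of_int n\<bar>"] by simp
  also have "\<bar>of_int q - of_int a / of_int n\<bar> * \<bar>of_int n\<bar> = \<bar>of_int (a - q * n) :: real\<bar>"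
    unfolding abs_mult[symmetric] using n by (simp add: left_diff_distrib abs_minus_commute)
  finally have "2 * \<bar>a - q * n\<bar> \<le> \<bar>n\<bar>" by linarith
  then show ?thesis by blast
qed

text \<open>Both coordinates of v / w are rounded. With n the norm of w, this leaves |c|, |d| <= |n|
  / 2, and |c^2 - 2 d^2| <= n^2 / 2 < n^2.\<close>

lemma znorm_division:
  assumes "znorm w \<noteq> 0"
  shows "\<exists>q. \<bar>znorm (v - q * w)\<bar> < \<bar>znorm w\<bar>"
proof -
  let ?n = "znorm w"
  obtain A B where AB: "v * zconj w = Zs A B" by (cases "v * zconj w")
  obtain q1 where q1: "2 * \<bar>A - q1 * ?n\<bar> \<le> \<bar>?n\<bar>" using nearest_multiple[OF assms] by blast
  obtain q2 where q2: "2 * \<bar>B - q2 * ?n\<bar> \<le> \<bar>?n\<bar>" using nearest_multiple[OF assms] by blast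
  define c where "c = A - q1 * ?n"
  define d where "d = B - q2 * ?n"
  have "(v - Zs q1 q2 * w) * zconj w = Zs c d"
  proof -
    have "(v - Zs q1 q2 * w) * zconj w = v * zconj w - Zs q1 q2 * (w * zconj w)" by (simp add: algebra_simps)
    then show ?thesis unfolding mult_zconj AB by (simp add: zsqrt2_ops c_def d_def)
  qed
  then have "znorm (v - Zs q1 q2 * w) * znorm (zconj w) = c\<^sup>2 - 2 * d\<^sup>2"
    unfolding znorm_mult[symmetric] by (simp add: znorm_def)
  moreover have "znorm (zconj w) = ?n" by (simp add: znorm_def zconj_def)
  ultimately have e: "\<bar>znorm (v - Zs q1 q2 * w)\<bar> * \<bar>?n\<bar> = \<bar>c\<^sup>2 - 2 * d\<^sup>2\<bar>" by (simp add: abs_mult[symmetric])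
  have sq: "4 * t\<^sup>2 \<le> ?n\<^sup>2" if "2 * \<bar>t\<bar> \<le> \<bar>?n\<bar>" for t
    using power_mono[OF that, of 2] by (simp add: power_mult_distrib)
  have "4 * c\<^sup>2 \<le> ?n\<^sup>2" "4 * d\<^sup>2 \<le> ?n\<^sup>2" using sq[of c] sq[of d] q1 q2 by (auto simp: c_def d_def)
  moreover have "?n\<^sup>2 > 0" using assms by simp
  moreover have "c\<^sup>2 \<ge> 0" "d\<^sup>2 \<ge> 0" by auto
  ultimately have "\<bar>c\<^sup>2 - 2 * d\<^sup>2\<bar> < ?n\<^sup>2" by linarith
  then have "\<bar>znorm (v - Zs q1 q2 * w)\<bar> * \<bar>?n\<bar> < \<bar>?n\<bar> * \<bar>?n\<bar>"
    unfolding e by (simp add: power2_eq_square abs_mult[symmetric])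
  then have "\<bar>znorm (v - Zs q1 q2 * w)\<bar> < \<bar>?n\<bar>" by (rule mult_right_less_imp_less) simp
  then show ?thesis by blast
qed

text \<open>In the ideal generated by v and w, an element of least nonzero absolute norm divides
  every other one. The explicit relation stands in for unique factorisation later.\<close>

lemma zsqrt2_bezout:
  assumes "znorm w \<noteq> 0"
  shows "\<exists>\<alpha> s t. \<alpha> = s * v + t * w \<and> \<alpha> dvd v \<and> \<alpha> dvd w"
proof -
  define I where "I = {\<alpha>. \<exists>s t. \<alpha> = s * v + t * w}"
  have "w = 0 * v + 1 * w" "v = 1 * v + 0 * w" by simp_all
  then have "w \<in> I" "v \<in> I" unfolding I_def by blast+
  obtain \<alpha> where \<alpha>: "\<alpha> \<in> I" "znorm \<alpha> \<noteq> 0"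
    and mn: "\<And>\<beta>. \<beta> \<in> I \<and> znorm \<beta> \<noteq> 0 \<Longrightarrow> nat \<bar>znorm \<alpha>\<bar> \<le> nat \<bar>znorm \<beta>\<bar>"
    using ex_has_least_nat[of "\<lambda>\<beta>. \<beta> \<in> I \<and> znorm \<beta> \<noteq> 0" w "\<lambda>\<beta>. nat \<bar>znorm \<beta>\<bar>"] \<open>w \<in> I\<close> assms by blast
  have dv: "\<alpha> dvd \<beta>" if \<beta>: "\<beta> \<in> I" for \<beta>
  proof -
    obtain q where q: "\<bar>znorm (\<beta> - q * \<alpha>)\<bar> < \<bar>znorm \<alpha>\<bar>" using znorm_division[OF \<alpha>(2)] by blast
    have "\<beta> - q * \<alpha> \<in> I"
    proof -
      obtain s t s' t' where "\<alpha> = s * v + t * w" "\<beta> = s' * v + t' * w" using \<alpha>(1) \<beta> unfolding I_def by auto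
      then have "\<beta> - q * \<alpha> = (s' - q * s) * v + (t' - q * t) * w" by (simp add: algebra_simps)
      then show ?thesis unfolding I_def by blast
    qed
    then have "znorm (\<beta> - q * \<alpha>) = 0" using mn[of "\<beta> - q * \<alpha>"] q by fastforce
    then have "\<beta> - q * \<alpha> = 0" by (rule znorm_eq_0)
    then show ?thesis by (metis dvd_triv_right eq_iff_diff_eq_0)
  qed
  show ?thesis using dv[OF \<open>v \<in> I\<close>] dv[OF \<open>w \<in> I\<close>] \<alpha>(1) unfolding I_def by blast
qed

abbreviation eps :: real where "eps \<equiv> 1 + sqrt 2"
abbreviation eps' :: real where "eps' \<equiv> 1 - sqrt 2"

lemma eps_mult: "eps * eps' = -1" by (simp add: algebra_simps)

text \<open>Descent on the irrational part b: norm 1 or -1 forces |b| <= |a| < 2 |b|, so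
  multiplication by eps or by its inverse \<open>Zs (-1) 1\<close>, according to the sign of a b,
  makes |b| smaller.\<close>

lemma zsqrt2_unit:
  assumes "\<bar>znorm v\<bar> = 1"
  shows "\<exists>(k::int) s. (s = 1 \<or> s = -1) \<and> zval v = s * eps powi k \<and> zval (zconj v) = s * eps' powi k"
  using assms
proof (induction "nat \<bar>irr_part v\<bar>" arbitrary: v rule: less_induct)
  case less
  obtain a b where v: "v = Zs a b" by (cases v)
  have n: "\<bar>a\<^sup>2 - 2 * b\<^sup>2\<bar> = 1" using less.prems v by (simp add: znorm_def)
  have e0: "eps \<noteq> 0" "eps' \<noteq> 0" using eps_mult by auto
  show ?case
  proof (cases "b = 0")
    case True
    then have "a = 1 \<or> a = -1" using n by (auto simp: abs_square_eq_1 power2_eq_1_iff)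
    then show ?thesis using v True by (intro exI[of _ 0] exI[of _ "of_int a"]) (auto simp: zval_def zconj_def)
  next
    case False
    then have b1: "b\<^sup>2 \<ge> 1" by (metis int_one_le_iff_zero_less zero_less_power2)
    have ab: "\<bar>b\<bar> \<le> \<bar>a\<bar>" "\<bar>a\<bar> < 2 * \<bar>b\<bar>"
    proof -
      have "b\<^sup>2 \<le> a\<^sup>2" using n b1 by linarith
      then show "\<bar>b\<bar> \<le> \<bar>a\<bar>" by (simp add: abs_le_square_iff)
      have "a\<^sup>2 < 4 * b\<^sup>2" using n b1 by linarith
      then have "\<bar>a\<bar>\<^sup>2 < (2 * \<bar>b\<bar>)\<^sup>2" by (simp add: power_mult_distrib)
      then show "\<bar>a\<bar> < 2 * \<bar>b\<bar>" by (rule power_less_imp_less_base) simp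
    qed
    show ?thesis
    proof (cases "a * b > 0")
      case True
      define w where "w = v * Zs (-1) 1"
      have "irr_part w = a - b" by (simp add: w_def v zsqrt2_ops)
      moreover have "\<bar>a - b\<bar> < \<bar>b\<bar>" using ab True False by (auto simp: zero_less_mult_iff abs_if split: if_splits)
      ultimately have "nat \<bar>irr_part w\<bar> < nat \<bar>irr_part v\<bar>" using v by simp
      moreover have "\<bar>znorm w\<bar> = 1" using less.prems by (simp add: w_def znorm_mult abs_mult) (simp add: znorm_def)
      ultimately obtain k s where ks: "s = 1 \<or> s = -1" "zval w = s * eps powi k" "zval (zconj w) = s * eps' powi k"
        using less.hyps by blast
      have "w * Zs 1 1 = v" by (simp add: w_def v zsqrt2_ops)
      then have "zval v = zval w * eps" "zval (zconj v) = zval (zconj w) * eps'"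
        by (auto simp: zval_def zconj_def zsqrt2_ops algebra_simps)
      then have "zval v = s * eps powi (k + 1)" "zval (zconj v) = s * eps' powi (k + 1)"
        using ks e0 by (auto simp: power_int_add)
      then show ?thesis using ks(1) by blast
    next
      case neg: False
      define w where "w = v * Zs 1 1"
      have "irr_part w = a + b" by (simp add: w_def v zsqrt2_ops)
      moreover have "\<bar>a + b\<bar> < \<bar>b\<bar>" using ab neg False by (auto simp: not_less mult_le_0_iff abs_if split: if_splits)
      ultimately have "nat \<bar>irr_part w\<bar> < nat \<bar>irr_part v\<bar>" using v by simp
      moreover have "\<bar>znorm w\<bar> = 1" using less.prems by (simp add: w_def znorm_mult abs_mult) (simp add: znorm_def)
      ultimately obtain k s where ks: "s = 1 \<or> s = -1" "zval w = s * eps powi k" "zval (zconj w) = s * eps' powi k"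
        using less.hyps by blast
      have "zval w = zval v * eps" "zval (zconj w) = zval (zconj v) * eps'"
        by (auto simp: w_def zval_def zconj_def zsqrt2_ops algebra_simps)
      then have "zval v = s * eps powi (k - 1)" "zval (zconj v) = s * eps' powi (k - 1)"
        using ks e0 by (auto simp: power_int_diff field_simps)
      then show ?thesis using ks(1) by blast
    qed
  qed
qed

lemma zsqrt2_eps_powi:
  "\<exists>v. zval v = eps powi k \<and> zval (zconj v) = eps' powi k \<and> \<bar>znorm v\<bar> = 1"
proof (cases "k \<ge> 0")
  case True
  have "zval (Zs 1 1) = eps" "zval (zconj (Zs 1 1)) = eps'" "\<bar>znorm (Zs 1 1)\<bar> = 1"
    by (auto simp: zval_def zconj_def znorm_def)
  then show ?thesis using True
    by (intro exI[of _ "Zs 1 1 ^ nat k"]) (simp add: power_int_def znorm_power power_abs)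
next
  case False
  have n: "\<bar>znorm (Zs (-1) 1)\<bar> = 1" by (simp add: znorm_def)
  have "inverse eps = zval (Zs (-1) 1)" "inverse eps' = zval (zconj (Zs (-1) 1))"
    by (rule inverse_unique; simp add: zval_def zconj_def algebra_simps)+
  then show ?thesis using False n
    by (intro exI[of _ "Zs (-1) 1 ^ nat (- k)"]) (simp add: power_int_def znorm_power power_abs)
qed

text \<open>A common divisor \<alpha> of \<xi> = x + sqrt 2 and y with a Bezout relation has norm y
  up to sign, and \<alpha>^p is \<xi> times a unit. Both facts come from the relation and from \<xi>
  \<xi>' = y^p.\<close>

lemma sqrt2_factorization:
  fixes x y :: int and p :: nat
  assumes eq: "x\<^sup>2 - 2 = y ^ p" and p: "odd p" and y: "y \<noteq> 0"
  shows "\<exists>\<alpha> r. 2 * \<bar>r\<bar> < int p \<and> \<bar>znorm \<alpha>\<bar> = \<bar>y\<bar> \<and>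
    of_int x + sqrt 2 = eps powi r * zval \<alpha> ^ p \<and> of_int x - sqrt 2 = eps' powi r * zval (zconj \<alpha>) ^ p"
proof -
  have p0: "p > 0" using p by (cases p) auto
  define \<xi> where "\<xi> = Zs x 1"
  define Y where "Y = Zs y 0"
  have Yp: "Y ^ n = Zs (y ^ n) 0" for n by (induction n) (auto simp: Y_def zsqrt2_ops)
  have \<xi>: "\<xi> * zconj \<xi> = Y ^ p" unfolding mult_zconj Yp using eq by (simp add: \<xi>_def znorm_def)
  have z\<xi>: "zval \<xi> = of_int x + sqrt 2" "zval (zconj \<xi>) = of_int x - sqrt 2"
    by (simp_all add: \<xi>_def zval_def zconj_def)
  have "znorm Y \<noteq> 0" using y by (simp add: Y_def znorm_def)
  then obtain \<alpha> s t where \<alpha>: "\<alpha> = s * \<xi> + t * Y" "\<alpha> dvd \<xi>" "\<alpha> dvd Y" using zsqrt2_bezout by blast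
  have cY: "zconj Y = Y" by (simp add: Y_def zconj_def)
  \<comment> \<open>Every term of the norm of s \<xi> + t Y contains Y, the first one because \<xi>
    times its conjugate is Y^p.\<close>
  have "y dvd znorm \<alpha>"
  proof -
    have "Zs (znorm \<alpha>) 0 = \<alpha> * zconj \<alpha>" by (rule mult_zconj[symmetric])
    also have "\<dots> = s * zconj s * (\<xi> * zconj \<xi>) + Y * (s * \<xi> * zconj t + t * zconj s * zconj \<xi> + t * zconj t * Y)"
      unfolding \<alpha>(1) by (simp add: cY algebra_simps)
    also have "\<dots> = Y * (s * zconj s * Y ^ (p - 1) + (s * \<xi> * zconj t + t * zconj s * zconj \<xi> + t * zconj t * Y))"
      unfolding \<xi> using p0 by (cases p) (auto simp: algebra_simps)
    finally obtain w where "Zs (znorm \<alpha>) 0 = Y * w" by blast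
    then have "znorm \<alpha> = y * rat_part w" by (simp add: Y_def zsqrt2_ops)
    then show ?thesis by simp
  qed
  \<comment> \<open>Y is its own conjugate, so \<alpha> and its conjugate divide \<xi> and Y
    respectively. Their product divides \<xi> Y, whose irrational part is y.\<close>
  moreover have "znorm \<alpha> dvd y"
  proof -
    obtain m k where mk: "\<xi> = \<alpha> * m" "Y = \<alpha> * k" using \<alpha>(2,3) by (auto simp: dvd_def)
    have "\<xi> * Y = \<xi> * zconj Y" by (simp add: cY)
    also have "\<dots> = (\<alpha> * zconj \<alpha>) * (m * zconj k)" unfolding mk by (simp add: mult_ac)
    finally have "\<xi> * Y = Zs (znorm \<alpha>) 0 * (m * zconj k)" unfolding mult_zconj .
    then have "irr_part (\<xi> * Y) = znorm \<alpha> * irr_part (m * zconj k)" by (simp add: times_zsqrt2_def)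
    then have "y = znorm \<alpha> * irr_part (m * zconj k)" by (simp add: \<xi>_def Y_def times_zsqrt2_def)
    then show ?thesis by (metis dvd_triv_left)
  qed
  ultimately have n\<alpha>: "\<bar>znorm \<alpha>\<bar> = \<bar>y\<bar>" by (metis abs_dvd_iff dvd_abs_iff zdvd_antisym_abs)
  \<comment> \<open>Modulo \<xi>, \<alpha> is t Y, and Y^p is a multiple of \<xi>.\<close>
  have "\<xi> dvd \<alpha> ^ p"
  proof -
    have "\<alpha> ^ p - (t * Y) ^ p = (\<alpha> - t * Y) * (\<Sum>i<p. (t * Y) ^ (p - Suc i) * \<alpha> ^ i)" by (rule power_diff_sumr2)
    then have "\<alpha> ^ p = \<xi> * (s * (\<Sum>i<p. (t * Y) ^ (p - Suc i) * \<alpha> ^ i)) + t ^ p * (\<xi> * zconj \<xi>)"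
      unfolding \<xi> using \<alpha>(1) by (simp add: power_mult_distrib algebra_simps)
    then have "\<alpha> ^ p = \<xi> * (s * (\<Sum>i<p. (t * Y) ^ (p - Suc i) * \<alpha> ^ i) + t ^ p * zconj \<xi>)" by (simp add: algebra_simps)
    then show ?thesis by (rule dvdI)
  qed
  then obtain v where v: "\<alpha> ^ p = \<xi> * v" by (auto simp: dvd_def)
  have "znorm \<xi> = y ^ p" using eq by (simp add: \<xi>_def znorm_def)
  then have "znorm \<alpha> ^ p = y ^ p * znorm v" using v by (metis znorm_mult znorm_power)
  then have "\<bar>y\<bar> ^ p = \<bar>y\<bar> ^ p * \<bar>znorm v\<bar>" using n\<alpha> by (metis abs_mult power_abs)
  then have nv: "\<bar>znorm v\<bar> = 1" using y by simp
  obtain k s' where ks: "s' = 1 \<or> s' = -1" "zval v = s' * eps powi k" "zval (zconj v) = s' * eps' powi k"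
    using zsqrt2_unit[OF nv] by blast
  \<comment> \<open>The unit exponent is reduced modulo p to r; the multiple of p and the sign are
    absorbed in \<beta>, since p is odd. Oddness also rules out 2 |r| = p.\<close>
  obtain q where q: "2 * \<bar>- k - q * int p\<bar> \<le> int p" using nearest_multiple[of "int p" "- k"] p0 by auto
  define r where "r = - k - q * int p"
  have "2 * \<bar>r\<bar> \<noteq> int p" using p by presburger
  then have r: "2 * \<bar>r\<bar> < int p" using q by (simp add: r_def)
  obtain w where w: "zval w = eps powi q" "zval (zconj w) = eps' powi q" "\<bar>znorm w\<bar> = 1" using zsqrt2_eps_powi by blast
  define \<beta> where "\<beta> = (if s' = 1 then 1 else -1) * (\<alpha> * w)"
  have z\<beta>: "zval \<beta> = s' * zval \<alpha> * eps powi q" "zval (zconj \<beta>) = s' * zval (zconj \<alpha>) * eps' powi q"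
    using ks(1) w by (auto simp: \<beta>_def)
  have e0: "eps \<noteq> 0" "eps' \<noteq> 0" using eps_mult by auto
  have s'p: "s' ^ p = s'" "s' * s' = 1" using ks(1) p by auto
  have gen: "X = e powi r * (s' * A * e powi q) ^ p" if e: "e \<noteq> 0" and A: "A ^ p = X * (s' * e powi k)" for e A X :: real
  proof -
    have "e powi r * (s' * A * e powi q) ^ p = e powi r * (s' * A ^ p * e powi (q * int p))"
      using s'p by (simp add: power_mult_distrib power_int_mult)
    also have "\<dots> = X * (e powi r * e powi k * e powi (q * int p)) * (s' * s')" unfolding A by (simp add: mult_ac)
    also have "e powi r * e powi k * e powi (q * int p) = 1"
      using e by (simp add: power_int_add[symmetric] r_def)
    finally show ?thesis using s'p by simp
  qed
  have "of_int x + sqrt 2 = eps powi r * zval \<beta> ^ p"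
  proof -
    have "zval \<alpha> ^ p = zval (\<alpha> ^ p)" by simp
    also have "\<dots> = (of_int x + sqrt 2) * (s' * eps powi k)" unfolding v using ks(2) z\<xi> by simp
    finally show ?thesis unfolding z\<beta> by (intro gen e0)
  qed
  moreover have "of_int x - sqrt 2 = eps' powi r * zval (zconj \<beta>) ^ p"
  proof -
    have "zval (zconj \<alpha>) ^ p = zval (zconj (\<alpha> ^ p))" by simp
    also have "\<dots> = (of_int x - sqrt 2) * (s' * eps' powi k)" unfolding v using ks(3) z\<xi> by simp
    finally show ?thesis unfolding z\<beta> by (intro gen e0)
  qed
  moreover have "\<bar>znorm \<beta>\<bar> = \<bar>y\<bar>" using n\<alpha> w(3) by (auto simp: \<beta>_def znorm_mult abs_mult) (simp add: znorm_def zsqrt2_ops)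
  ultimately show ?thesis using r by blast
qed

subsection \<open>The arithmetic lower bound\<close>

text \<open>The two real embeddings of one ring element. As a relation it lets a real computation
  and its conjugate run in parallel.\<close>

definition zpair :: "real \<Rightarrow> real \<Rightarrow> bool" where
  "zpair X X' \<longleftrightarrow> (\<exists>v. X = zval v \<and> X' = zval (zconj v))"

lemma zpair_mult: "zpair X X' \<Longrightarrow> zpair W W' \<Longrightarrow> zpair (X * W) (X' * W')"
  unfolding zpair_def by (metis zval_simps(2) zconj_simps(2))

lemma zpair_sum: "(\<And>i. i \<in> A \<Longrightarrow> zpair (f i) (g i)) \<Longrightarrow> zpair (sum f A) (sum g A)"
proof (induction A rule: infinite_finite_induct)
  case (insert x A)
  then have "zpair (f x) (g x)" "zpair (sum f A) (sum g A)" by auto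
  then have "zpair (f x + sum f A) (g x + sum g A)" unfolding zpair_def by (metis zval_simps(3) zconj_simps(3))
  then show ?case using insert by simp
qed (auto simp: zpair_def intro!: exI[of _ 0])

lemma zpair_of_int: "zpair (of_int a) (of_int a)"
  unfolding zpair_def by (rule exI[of _ "Zs a 0"]) (simp add: zconj_def)

text \<open>Liouville's inequality at its best: the norm, X^2 up to sign, is a nonzero
  integer.\<close>

lemma zpair_self_ge_1:
  assumes "zpair X X'" "X \<noteq> 0" "X' = X \<or> X' = - X"
  shows "\<bar>X\<bar> \<ge> 1"
proof -
  obtain v where v: "X = zval v" "X' = zval (zconj v)" using assms unfolding zpair_def by auto
  then have n: "X * X' = of_int (znorm v)" by (simp add: zval_mult_zconj)
  then have "znorm v \<noteq> 0" using assms by auto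
  then have "\<bar>of_int (znorm v) :: real\<bar> \<ge> 1" by linarith
  moreover have "\<bar>X * X'\<bar> = \<bar>X\<bar>\<^sup>2" using assms(3) by (auto simp: abs_mult power2_eq_square)
  ultimately have "1\<^sup>2 \<le> \<bar>X\<bar>\<^sup>2" using n by simp
  then show ?thesis by (rule power2_le_imp_le) simp
qed

lemma zpair_eps_sq: "zpair (eps\<^sup>2 powi A) (eps\<^sup>2 powi (- A))"
proof -
  obtain v where v: "zval v = eps powi (2 * A)" "zval (zconj v) = eps' powi (2 * A)" using zsqrt2_eps_powi by blast
  have e: "eps\<^sup>2 * eps'\<^sup>2 = 1" unfolding power_mult_distrib[symmetric] eps_mult by simp
  then have "eps'\<^sup>2 = inverse (eps\<^sup>2)" by (metis inverse_unique)
  then have "eps' powi (2 * A) = eps\<^sup>2 powi (- A)"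
    by (simp add: power_int_mult power_int_minus power_int_inverse)
  moreover have "eps powi (2 * A) = eps\<^sup>2 powi A" by (simp add: power_int_mult)
  ultimately show ?thesis unfolding zpair_def using v by metis
qed

text \<open>Since y = \<sigma> \<alpha> \<alpha>', the factor y^M clears the denominator of
  \<gamma>^B: up to sign the product is \<alpha>'^(M + B) \<alpha>^(M - B), and conjugation swaps
  the exponents. The signs agree because M + B and M - B have the same parity.\<close>

lemma zpair_ratio:
  fixes y B :: int and M :: nat
  assumes \<sigma>: "\<sigma> = 1 \<or> \<sigma> = -1" and n: "zval \<alpha> * zval (zconj \<alpha>) = of_int (\<sigma> * y)" and y: "y \<noteq> 0"
    and B: "\<bar>B\<bar> \<le> int M"
  defines "\<gamma> \<equiv> of_int \<sigma> * zval (zconj \<alpha>) / zval \<alpha>"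
  shows "zpair (\<gamma> powi B * of_int y ^ M) (\<gamma> powi (- B) * of_int y ^ M)"
proof -
  define a a' where "a = zval \<alpha>" and "a' = zval (zconj \<alpha>)"
  define s where "s = (of_int \<sigma> :: real)"
  have s: "s = 1 \<or> s = -1" using \<sigma> by (auto simp: s_def)
  have ss: "s * s = 1" using s by auto
  have aa: "a * a' = s * of_int y" using n by (simp add: a_def a'_def s_def)
  have a0: "a \<noteq> 0" "a' \<noteq> 0" using aa y s by auto
  have yy: "of_int y = s * (a * a')" unfolding aa mult.assoc[symmetric] ss by simp
  have key: "\<gamma> powi C * of_int y ^ M = s ^ nat (int M + C) * (a' ^ nat (int M + C) * a ^ nat (int M - C))"
    if C: "\<bar>C\<bar> \<le> int M" for C
  proof -
    have s0: "s \<noteq> 0" using s by auto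
    have "\<gamma> powi C * of_int y ^ M = (s * a' * inverse a) powi C * (s * a * a') powi (int M)"
      unfolding yy \<gamma>_def by (simp add: a_def a'_def s_def divide_inverse mult_ac)
    also have "\<dots> = s powi C * s powi int M * (a' powi C * a' powi int M) * (a powi int M * a powi (- C))"
      by (simp only: power_int_mult_distrib power_int_inverse power_int_minus mult_ac)
    also have "\<dots> = s powi (int M + C) * a' powi (int M + C) * a powi (int M - C)"
      using a0 s0 by (simp add: power_int_add power_int_diff power_int_minus divide_inverse mult_ac)
    also have "\<dots> = s ^ nat (int M + C) * a' ^ nat (int M + C) * a ^ nat (int M - C)"
      using C by (simp add: power_int_def)
    finally show ?thesis by (simp add: mult_ac)
  qed
  have sp: "s ^ nat (int M - B) = s ^ nat (int M + B)"
  proof -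
    have "even (nat (int M - B)) = even (nat (int M + B))" using B by (simp add: even_nat_iff)
    then show ?thesis using s by (auto simp: minus_one_power_iff)
  qed
  define v where "v = Zs \<sigma> 0 ^ nat (int M + B) * (zconj \<alpha> ^ nat (int M + B) * \<alpha> ^ nat (int M - B))"
  have "zval v = \<gamma> powi B * of_int y ^ M"
    unfolding key[OF B] v_def by (simp add: a_def a'_def s_def)
  moreover have "zval (zconj v) = \<gamma> powi (- B) * of_int y ^ M"
  proof -
    have "zconj (Zs \<sigma> 0) = Zs \<sigma> 0" by (simp add: zconj_def)
    then have "zval (zconj v) = s ^ nat (int M + B) * (a ^ nat (int M + B) * a' ^ nat (int M - B))"
      unfolding v_def by (simp add: a_def a'_def s_def)
    moreover have "\<bar>- B\<bar> \<le> int M" using B by simp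
    ultimately show ?thesis unfolding key[OF \<open>\<bar>- B\<bar> \<le> int M\<close>] by (simp add: sp mult_ac)
  qed
  ultimately show ?thesis unfolding zpair_def by metis
qed

lemma prod_power_int:
  fixes x :: real
  assumes "x \<noteq> 0"
  shows "(\<Prod>c\<in>A. x powi f c) = x powi (\<Sum>c\<in>A. f c)"
  using assms by (induction A rule: infinite_finite_induct) (auto simp: power_int_add)

text \<open>Argued through \<open>pochhammer\<close> because \<open>z\<close> may be
  negative.\<close>

lemma falling_div_fact_int:
  fixes z :: int
  shows "\<exists>n::int. (\<Prod>m<k. of_int z - real m) / fact k = of_int n"
proof -
  have "(\<Prod>i = 0..<k. z - int i) = pochhammer (z - int k + 1) k" by (rule falling_fact_pochhammer')
  then have "fact k dvd (\<Prod>i = 0..<k. z - int i)" by (simp add: fact_dvd_pochhammer)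
  then obtain n where "(\<Prod>i = 0..<k. z - int i) = fact k * n" by (auto simp: dvd_def)
  then have "real_of_int (\<Prod>i = 0..<k. z - int i) = of_int (fact k * n)" by simp
  then have "(\<Prod>m<k. of_int z - real m) = fact k * of_int n" by (simp add: atLeast0LessThan)
  then show ?thesis by (intro exI[of _ n]) simp
qed

lemma fdet_permute:
  fixes F :: "nat \<Rightarrow> nat \<Rightarrow> real"
  assumes "q permutes {0..<N}"
  shows "fdet N (\<lambda>c. F (q c)) = signof q * fdet N F"
proof -
  have q: "q c < N" if "c < N" for c using permutes_in_image[OF assms, of c] that by simp
  have "mat N N (\<lambda>(c, t). mat N N (\<lambda>(c, t). F c t) $$ (q c, t)) = mat N N (\<lambda>(c, t). F (q c) t)"
    using q by (intro eq_matI) auto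
  then show ?thesis using det_permute_rows[of "mat N N (\<lambda>(c, t). F c t)" N, OF _ assms] unfolding fdet_def by simp
qed

text \<open>Row c carries the binomial index c mod K and the exponent index c div K. This is the
  index arithmetic of the row permutation that reverses the exponents and keeps the
  binomials.\<close>

lemma block_index:
  fixes K L c :: nat
  assumes "c < K * L"
  shows "(L - 1 - c div K) * K + c mod K < K * L"
    "((L - 1 - c div K) * K + c mod K) div K = L - 1 - c div K"
    "((L - 1 - c div K) * K + c mod K) mod K = c mod K"
proof -
  have K: "K > 0" using assms by (cases K) auto
  show 1: "((L - 1 - c div K) * K + c mod K) div K = L - 1 - c div K" using K by simp
  show "((L - 1 - c div K) * K + c mod K) mod K = c mod K" by simp
  have "c div K < L" using assms by (simp add: less_mult_imp_div_less mult.commute)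
  then have "Suc (L - 1 - c div K) * K \<le> L * K" by (intro mult_le_mono1) simp
  moreover have "c mod K < K" using K by simp
  ultimately show "(L - 1 - c div K) * K + c mod K < K * L" by (simp add: mult.commute)
qed

text \<open>Galois conjugation inverts both \<open>eps\<^sup>2\<close> and \<open>\<gamma>\<close>, hence only reverses the order of the exponents
  \<open>-h, \<dots>, h\<close>: the determinant is fixed up to sign, and its norm is its square up to sign.\<close>

lemma fdet_lower_bound:
  fixes y h r :: int and M K L p :: nat and pts :: "nat \<Rightarrow> int \<times> int"
  assumes \<sigma>: "\<sigma> = 1 \<or> \<sigma> = -1" and n: "zval \<alpha> * zval (zconj \<alpha>) = of_int (\<sigma> * y)" and y: "y \<noteq> 0"
    and L: "int L = 2 * h + 1"
  defines "\<gamma> \<equiv> of_int \<sigma> * zval (zconj \<alpha>) / zval \<alpha>"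
  defines "z \<equiv> \<lambda>(i, j). real p * of_int i + of_int r * of_int j"
    and "u \<equiv> \<lambda>(i, j). eps\<^sup>2 powi i * \<gamma> powi j"
  assumes M: "\<And>q. q permutes {0..<K*L} \<Longrightarrow> \<bar>\<Sum>c=0..<K*L. (int (c div K) - h) * snd (pts (q c))\<bar> \<le> int M"
  defines "F \<equiv> \<lambda>c t. (\<Prod>m<c mod K. z (pts t) - real m) / fact (c mod K) * u (pts t) powi (int (c div K) - h)"
  assumes F0: "fdet (K * L) F \<noteq> 0"
  shows "\<bar>fdet (K * L) F\<bar> * \<bar>of_int y\<bar> ^ M \<ge> 1"
proof -
  let ?N = "K * L"
  have a0: "zval \<alpha> \<noteq> 0" "zval (zconj \<alpha>) \<noteq> 0" using n y \<sigma> by auto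
  then have \<gamma>0: "\<gamma> \<noteq> 0" using \<sigma> by (auto simp: \<gamma>_def)
  have e0: "eps\<^sup>2 \<noteq> 0" using eps_mult by auto
  \<comment> \<open>\<open>G 1\<close> gives the determinant and \<open>G (-1)\<close> its
    conjugate; they are compared term by term in the Leibniz expansion.\<close>
  define G where "G s c t = (\<Prod>m<c mod K. z (pts t) - real m) / fact (c mod K) * u (pts t) powi (s * (int (c div K) - h))" for s :: int and c t
  have F: "F = G 1" by (simp add: F_def G_def fun_eq_iff)
  have upow: "u e powi d = eps\<^sup>2 powi (d * fst e) * \<gamma> powi (d * snd e)" for e d
    by (cases e) (simp add: u_def power_int_mult_distrib mult.commute[of d] power_int_mult)
  have zp: "zpair (fdet ?N (G 1) * of_int y ^ M) (fdet ?N (G (-1)) * of_int y ^ M)"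
    unfolding fdet_eq sum_distrib_right
  proof (rule zpair_sum)
    fix q assume "q \<in> {q. q permutes {0..<?N}}"
    then have q: "q permutes {0..<?N}" by simp
    define A where "A = (\<Sum>c=0..<?N. (int (c div K) - h) * fst (pts (q c)))"
    define B where "B = (\<Sum>c=0..<?N. (int (c div K) - h) * snd (pts (q c)))"
    have "\<exists>n::int. (\<Prod>m<c mod K. z (pts t) - real m) / fact (c mod K) = of_int n" for c t
      using falling_div_fact_int[where k = "c mod K" and z = "int p * fst (pts t) + r * snd (pts t)"] by (cases "pts t") (simp add: z_def)
    moreover define Q where "Q c t = \<lfloor>(\<Prod>m<c mod K. z (pts t) - real m) / fact (c mod K)\<rfloor>" for c t
    ultimately have Q: "(\<Prod>m<c mod K. z (pts t) - real m) / fact (c mod K) = of_int (Q c t)" for c t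
      by (metis floor_of_int)
    have pp: "(\<Prod>c=0..<?N. G s c (q c)) = of_int (\<Prod>c=0..<?N. Q c (q c)) * (eps\<^sup>2 powi (s * A) * \<gamma> powi (s * B))" for s
    proof -
      have "(\<Prod>c=0..<?N. G s c (q c)) = of_int (\<Prod>c=0..<?N. Q c (q c)) * (\<Prod>c=0..<?N. eps\<^sup>2 powi (s * ((int (c div K) - h) * fst (pts (q c)))) * \<gamma> powi (s * ((int (c div K) - h) * snd (pts (q c)))))"
        unfolding G_def Q of_int_prod prod.distrib[symmetric]
        by (intro prod.cong refl) (simp only: upow mult.assoc)
      also have "(\<Prod>c=0..<?N. eps\<^sup>2 powi (s * ((int (c div K) - h) * fst (pts (q c)))) * \<gamma> powi (s * ((int (c div K) - h) * snd (pts (q c))))) = eps\<^sup>2 powi (s * A) * \<gamma> powi (s * B)"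
        unfolding prod.distrib A_def B_def sum_distrib_left
        by (simp only: prod_power_int[OF e0] prod_power_int[OF \<gamma>0])
      finally show ?thesis .
    qed
    have "zpair (of_int (sign q * (\<Prod>c=0..<?N. Q c (q c))) * (eps\<^sup>2 powi A * (\<gamma> powi B * of_int y ^ M)))
       (of_int (sign q * (\<Prod>c=0..<?N. Q c (q c))) * (eps\<^sup>2 powi (- A) * (\<gamma> powi (- B) * of_int y ^ M)))"
      unfolding \<gamma>_def using M[OF q] \<sigma> n y by (intro zpair_mult zpair_of_int zpair_eps_sq zpair_ratio) (auto simp: B_def)
    then show "zpair (signof q * (\<Prod>c=0..<?N. G 1 c (q c)) * of_int y ^ M) (signof q * (\<Prod>c=0..<?N. G (-1) c (q c)) * of_int y ^ M)"
      unfolding pp by (simp add: mult_ac)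
  qed
  define q where "q c = (if c < ?N then (L - 1 - c div K) * K + c mod K else c)" for c
  have qq: "q (q c) = c" for c
  proof (cases "c < ?N")
    case True
    then have "c div K < L" by (simp add: less_mult_imp_div_less mult.commute)
    then show ?thesis using True block_index[OF True] by (simp add: q_def)
  next
    case False then show ?thesis by (simp add: q_def)
  qed
  have qp: "q permutes {0..<?N}"
    unfolding permutes_def using qq by (metis atLeast0LessThan lessThan_iff q_def)
  have "fdet ?N (G (-1)) = fdet ?N (\<lambda>c. G 1 (q c))"
  proof (rule fdet_cong)
    fix c t assume c: "c < ?N"
    then have "c div K < L" by (simp add: less_mult_imp_div_less mult.commute)
    then have "int (q c div K) - h = - 1 * (int (c div K) - h)"
      unfolding q_def if_P[OF c] block_index(2)[OF c] using L by (simp add: of_nat_diff)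
    moreover have "q c mod K = c mod K" using c by (simp add: q_def)
    ultimately show "G (-1) c t = G 1 (q c) t" by (simp only: G_def mult_1)
  qed
  then have "fdet ?N (G (-1)) = signof q * fdet ?N (G 1)" using fdet_permute[OF qp, of "G 1"] by simp
  then have "fdet ?N (G (-1)) * of_int y ^ M = fdet ?N (G 1) * of_int y ^ M \<or> fdet ?N (G (-1)) * of_int y ^ M = - (fdet ?N (G 1) * of_int y ^ M)"
    by (auto simp: sign_def)
  from zpair_self_ge_1[OF zp _ this] show ?thesis using F0 y by (simp add: F abs_mult power_abs)
qed

subsection \<open>The interpolation determinant\<close>

lemma ln_powi: "x > 0 \<Longrightarrow> ln (x powi n) = of_int n * ln (x :: real)"
  by (cases "n \<ge> 0") (auto simp: power_int_def ln_realpow ln_inverse power_inverse)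

lemma ln_fact_ge: "ln (fact k) \<ge> real k * ln (real k) - real k"
proof (induction k)
  case (Suc k)
  show ?case
  proof (cases "k = 0")
    case False
    have "ln (real (Suc k)) - ln (real k) \<le> (real (Suc k) - real k) / real k" using False by (intro ln_diff_le) auto
    then have "real k * (ln (real (Suc k)) - ln (real k)) \<le> real k * (1 / real k)" by (intro mult_left_mono) auto
    then have "real k * ln (real (Suc k)) - real k * ln (real k) \<le> 1" using False by (simp add: right_diff_distrib)
    moreover have "ln (fact (Suc k) :: real) = ln (real (Suc k)) + ln (fact k)"
      by (simp add: ln_mult_pos del: of_nat_Suc)
    ultimately show ?thesis using Suc by (simp add: distrib_right)
  qed simp
qed simp

text \<open>An averaged Stirling bound. Its main term turns ln (Z cosh 2 + K) into ln (Z cosh 2 / K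
  + 1) in the final estimate; the induction uses only x (ln (x + 1) - ln x) <= 1.\<close>

lemma sum_ln_fact_ge:
  assumes "K > 0"
  shows "(\<Sum>k<K. ln (fact k :: real)) \<ge> real K * (real K - 1) / 2 * ln (real K) - 3 / 4 * (real K)\<^sup>2"
proof -
  have "(\<Sum>k<Suc K. ln (fact k :: real)) \<ge> real (Suc K) * (real (Suc K) - 1) / 2 * ln (real (Suc K)) - 3 / 4 * (real (Suc K))\<^sup>2" for K
  proof (induction K)
    case (Suc K)
    define x where "x = real (Suc K)"
    have x1: "x \<ge> 1" by (simp add: x_def)
    define d where "d = ln (x + 1) - ln x"
    have "d \<le> ((x + 1) - x) / x" unfolding d_def using x1 by (intro ln_diff_le) auto
    then have xd: "x * d \<le> 1" using x1 by (simp add: field_simps)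
    then have xd2: "x * (x * d) \<le> x * 1" using x1 by (intro mult_left_mono) auto
    have F: "ln (fact (Suc K)) \<ge> x * ln x - x" using ln_fact_ge[of "Suc K"] by (simp add: x_def)
    have IH: "(\<Sum>k<Suc K. ln (fact k :: real)) \<ge> x * (x - 1) / 2 * ln x - 3 / 4 * x\<^sup>2" using Suc by (simp add: x_def)
    have "real (Suc (Suc K)) = x + 1" by (simp add: x_def)
    moreover have "(x + 1) * (x + 1 - 1) / 2 * ln (x + 1) - 3 / 4 * (x + 1)\<^sup>2 \<le> (x * (x - 1) / 2 * ln x - 3 / 4 * x\<^sup>2) + (x * ln x - x)"
    proof -
      have "ln (x + 1) = ln x + d" by (simp add: d_def)
      then have "(x + 1) * (x + 1 - 1) / 2 * ln (x + 1) = (x * (x - 1) / 2 * ln x) + x * ln x + (x * (x * d) + x * d) / 2"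
        by (simp add: field_simps)
      moreover have "3 / 4 * (x + 1)\<^sup>2 = 3 / 4 * x\<^sup>2 + 3 / 2 * x + 3 / 4" by (simp add: power2_eq_square field_simps)
      ultimately show ?thesis using xd xd2 by (simp only:) argo
    qed
    ultimately have "real (Suc (Suc K)) * (real (Suc (Suc K)) - 1) / 2 * ln (real (Suc (Suc K))) - 3 / 4 * (real (Suc (Suc K)))\<^sup>2
      \<le> (x * (x - 1) / 2 * ln x - 3 / 4 * x\<^sup>2) + (x * ln x - x)" by (simp only:)
    also have "\<dots> \<le> (\<Sum>k<Suc K. ln (fact k)) + ln (fact (Suc K))" using IH F by (rule add_mono)
    also have "\<dots> = (\<Sum>k<Suc (Suc K). ln (fact k))" by (rule sum.lessThan_Suc[symmetric])
    finally show ?case .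
  qed simp
  from this[of "K - 1"] show ?thesis using assms by simp
qed

lemma sum_mod_div:
  fixes \<phi> \<psi> :: "nat \<Rightarrow> real"
  assumes "K > 0"
  shows "(\<Sum>c<K*L. \<phi> (c mod K) + \<psi> (c div K)) = real L * (\<Sum>k<K. \<phi> k) + real K * (\<Sum>l<L. \<psi> l)"
proof -
  have "(\<Sum>c<L*K. \<phi> (c mod K) + \<psi> (c div K)) = (\<Sum>l<L. \<Sum>c = l * K..<l * K + K. \<phi> (c mod K) + \<psi> (c div K))"
    by (rule sum.nat_group[symmetric])
  also have "\<dots> = (\<Sum>l<L. \<Sum>k<K. \<phi> ((l * K + k) mod K) + \<psi> ((l * K + k) div K))"
    by (rule sum.cong[OF refl], subst sum.atLeastLessThan_shift_0) (simp only: add_diff_cancel_left' atLeast0LessThan comp_def)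
  also have "\<dots> = (\<Sum>l<L. \<Sum>k<K. \<phi> k + \<psi> l)" by (intro sum.cong refl) auto
  also have "\<dots> = real L * (\<Sum>k<K. \<phi> k) + real K * (\<Sum>l<L. \<psi> l)" by (simp add: sum.distrib sum_distrib_left)
  finally show ?thesis by (simp add: mult.commute)
qed

lemma sum_centered:
  shows "(\<Sum>l<2*h+1. \<bar>real l - real h\<bar>) = real h * (real h + 1)"
    and "(\<Sum>l<2*h+1. (real l - real h)\<^sup>2) = real h * (real h + 1) * (2 * real h + 1) / 3"
proof (induction h)
  case (Suc h)
  have shift: "(\<Sum>l<2 * Suc h + 1. f (real l - real (Suc h))) = f (- 1 - real h) + (\<Sum>l<2*h+1. f (real l - real h)) + f (real h + 1)"
    for f :: "real \<Rightarrow> real"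
  proof -
    have "(\<Sum>l<2 * Suc h + 1. f (real l - real (Suc h))) = (\<Sum>l<Suc (Suc (2 * h + 1)). f (real l - real (Suc h)))" by simp
    also have "\<dots> = f (- 1 - real h) + (\<Sum>l<Suc (2 * h + 1). f (real l - real h))"
      by (subst sum.lessThan_Suc_shift) simp
    also have "(\<Sum>l<Suc (2 * h + 1). f (real l - real h)) = (\<Sum>l<2 * h + 1. f (real l - real h)) + f (real h + 1)"
      by (subst sum.lessThan_Suc) simp
    finally show ?thesis by simp
  qed
  { case 1 show ?case unfolding shift using Suc(1) by (simp add: algebra_simps) }
  { case 2 show ?case unfolding shift[of "\<lambda>d. d\<^sup>2"] using Suc(2) by (simp add: power2_eq_square field_simps) }
qed auto

lemma sum_squares_interval: "(\<Sum>j\<in>{- int S..int S}. (real_of_int j)\<^sup>2) = real S * (real S + 1) * (2 * real S + 1) / 3"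
proof (induction S)
  case (Suc S)
  have "{- int (Suc S)..int (Suc S)} = insert (- int (Suc S)) (insert (int (Suc S)) {- int S..int S})" by auto
  then show ?case using Suc by (simp add: power2_eq_square field_simps)
qed simp

text \<open>\<open>grid\<close> supplies the points for the zero estimate, \<open>C2\<close> makes
  the deviation caused by \<Lambda> small enough for the Chebyshev bound with \<mu> = 2, and
  \<open>Mb\<close> bounds the power of y in the denominators. \<open>C3\<close> then compares, in
  logarithms, the gain N (N - 1) with all costs.\<close>

lemma interpolation_contradiction:
  fixes p K h R S Rd :: nat and y r \<sigma> :: int and \<alpha> :: zsqrt2 and lam Mb :: real
  assumes \<sigma>: "\<sigma> = 1 \<or> \<sigma> = -1" and n: "zval \<alpha> * zval (zconj \<alpha>) = of_int (\<sigma> * y)" and y: "y \<ge> 2"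
  defines "\<gamma> \<equiv> of_int \<sigma> * zval (zconj \<alpha>) / zval \<alpha>"
  assumes \<gamma>: "\<gamma> > 0" and p: "prime p" and r: "2 * \<bar>r\<bar> < int p" "r \<noteq> 0"
    and lam: "\<bar>real p * ln \<gamma> - of_int r * ln (eps\<^sup>2)\<bar> \<le> lam"
    and K: "K > 0" and S: "S > 0"
    and grid: "Rd * (2 * S + 1) > (K - 1) * (2 * h + 1)" "Rd + 2 * h \<le> 2 * R + 1" "2 * S + 1 \<le> p"
  defines "N \<equiv> K * (2 * h + 1)"
  defines "W \<equiv> real R + real S / 2"
  assumes C2: "4 * (real h * real S * lam / real p) * real N * exp (2 * real N) \<le> 1"
    and Mb: "Mb \<ge> 0" "Mb\<^sup>2 \<ge> real K * (real h * (real h + 1) * (2 * real h + 1) / 3) * ((2 * real R + 1) * (real S * (real S + 1) * (2 * real S + 1) / 3))"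
    and C3: "real N * ln (2 * real N) + 1 + real (2 * h + 1) * (real K * (real K - 1) / 2) * ln (real p * W * cosh 2 / real K + 1)
      + 3 / 4 * real (2 * h + 1) * (real K)\<^sup>2 + real K * (real h * (real h + 1)) * (ln (eps\<^sup>2) * W * cosh 2) + Mb * ln (of_int y)
      < real N * (real N - 1)"
  shows False
proof -
  define L where "L = 2 * h + 1"
  have NKL: "N = K * L" by (simp add: N_def L_def)
  have N0: "N > 0" using K by (simp add: NKL L_def)
  define z where "z = (\<lambda>(i::int, j::int). real p * of_int i + of_int r * of_int j)"
  define u where "u = (\<lambda>(i::int, j::int). eps\<^sup>2 powi i * \<gamma> powi j)"
  define E where "E = {- int R..int R} \<times> {- int S..int S}"
  define E' where "E' = {- int R..<- int R + int Rd + int L - 1} \<times> {- int S..<- int S + int (2 * S + 1)}"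
  have EE: "E' \<subseteq> E" unfolding E'_def E_def using grid(2) by (auto simp: L_def)
  have p0: "p > 0" using p prime_gt_0_nat by blast
  have w1: "eps\<^sup>2 > 1" by (simp add: one_less_power)
  define g where "g c e = (\<Prod>m<c mod K. z e - real m) / fact (c mod K) * u e powi (int (c div K) - int h)" for c e
  have inj: "inj_on z ({- int R..<- int R + int Rd} \<times> {- int S..<- int S + int (2 * S + 1)})"
  proof (rule inj_onI, clarify)
    fix i j i' j'
    assume j: "j \<in> {- int S..<- int S + int (2 * S + 1)}" "j' \<in> {- int S..<- int S + int (2 * S + 1)}"
      and eq: "z (i, j) = z (i', j')"
    have "real_of_int (int p * i + r * j) = real_of_int (int p * i' + r * j')" using eq by (simp add: z_def)
    then have eq': "int p * i + r * j = int p * i' + r * j'" by linarith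
    then have "r * (j - j') = int p * (i' - i)" by (simp add: algebra_simps)
    then have "int p dvd r * (j - j')" by simp
    moreover have "\<not> int p dvd r" using r zdvd_imp_le[of "int p" "\<bar>r\<bar>"] by auto
    moreover have "prime (int p)" using p by simp
    ultimately have d: "int p dvd j - j'" using prime_dvd_mult_iff by blast
    have "\<bar>j - j'\<bar> < int p" using j grid(3) by auto
    then have "j = j'" using d zdvd_imp_le[of "int p" "\<bar>j - j'\<bar>"] by fastforce
    then show "i = i' \<and> j = j'" using eq' p0 by simp
  qed
  have "\<exists>pts. (\<forall>t<N. pts t \<in> E') \<and> fdet N (\<lambda>c t. g c (pts t)) \<noteq> 0"
  proof (rule exists_points_fdet_nonzero)
    fix a c assume a: "\<And>e. e \<in> E' \<Longrightarrow> (\<Sum>c<N. a c * g c e) = 0" and c: "c < N"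
    show "a c = 0"
    proof (rule grid_independent[OF w1 \<gamma>, of "real p" "of_int r" "- int R" Rd "- int S" "2 * S + 1" K L a "int h"])
      show "inj_on (\<lambda>(i, j). real p * of_int i + of_int r * of_int j) ({- int R..<- int R + int Rd} \<times> {- int S..<- int S + int (2 * S + 1)})"
        using inj unfolding z_def .
      show "(K - 1) * L < Rd * (2 * S + 1)" using grid(1) by (simp add: L_def)
      show "c < K * L" using c NKL by simp
    qed (use a in \<open>auto simp: g_def z_def u_def E'_def NKL\<close>)
  qed
  then obtain pts where pts: "\<And>t. t < N \<Longrightarrow> pts t \<in> E'" and det0: "fdet N (\<lambda>c t. g c (pts t)) \<noteq> 0" by blast
  define F where "F = (\<lambda>c t. g c (pts t))"
  have ptsE: "pts t \<in> E" if "t < N" for t using pts[OF that] EE by auto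
  \<comment> \<open>A repeated point would give equal columns. Distinctness lets sums over the
    chosen points be bounded by sums over the rectangle \<open>E\<close>.\<close>
  have injp: "inj_on pts {0..<N}"
  proof (rule inj_onI, rule ccontr)
    fix s t assume st: "s \<in> {0..<N}" "t \<in> {0..<N}" "pts s = pts t" "s \<noteq> t"
    have "fdet N (\<lambda>c t. g t (pts c)) = 0" by (rule fdet_identical[of s N t]) (use st in auto)
    then show False using det0 fdet_transpose[of N "\<lambda>c t. g c (pts t)"] by simp
  qed
  \<comment> \<open>Cauchy-Schwarz bounds the exponent of \<gamma> uniformly in the permutation,
    since neither sum of squares depends on \<open>q\<close>.\<close>
  have Mbound: "\<bar>\<Sum>c=0..<K*L. (int (c div K) - int h) * snd (pts (q c))\<bar> \<le> int (nat \<lfloor>Mb\<rfloor>)" if q: "q permutes {0..<K*L}" for q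
  proof -
    let ?l = "\<lambda>c. real (c div K) - real h"
    let ?j = "\<lambda>t. real_of_int (snd (pts t))"
    have "(\<Sum>c=0..<N. ?l c * ?j (q c))\<^sup>2 \<le> (\<Sum>c=0..<N. (?l c)\<^sup>2) * (\<Sum>c=0..<N. (?j (q c))\<^sup>2)"
      by (rule Cauchy_Schwarz_ineq_sum)
    also have "(\<Sum>c=0..<N. (?l c)\<^sup>2) = real K * (real h * (real h + 1) * (2 * real h + 1) / 3)"
      using sum_mod_div[OF K, where L = L and \<phi> = "\<lambda>_. 0" and \<psi> = "\<lambda>l. (real l - real h)\<^sup>2"] sum_centered(2)[of h] by (simp add: NKL L_def atLeast0LessThan)
    also have "(\<Sum>c=0..<N. (?j (q c))\<^sup>2) = (\<Sum>t=0..<N. (?j t)\<^sup>2)"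
      using sum.permute[OF q, of "\<lambda>t. (?j t)\<^sup>2"] by (simp add: NKL comp_def)
    also have "(\<Sum>t=0..<N. (?j t)\<^sup>2) = (\<Sum>e\<in>pts ` {0..<N}. (real_of_int (snd e))\<^sup>2)" using injp by (simp add: sum.reindex)
    also have "real K * (real h * (real h + 1) * (2 * real h + 1) / 3) * (\<Sum>e\<in>pts ` {0..<N}. (real_of_int (snd e))\<^sup>2) \<le>
       real K * (real h * (real h + 1) * (2 * real h + 1) / 3) * (\<Sum>e\<in>E. (real_of_int (snd e))\<^sup>2)"
    proof (intro mult_left_mono sum_mono2)
      show "finite E" by (simp add: E_def)
      show "pts ` {0..<N} \<subseteq> E" using ptsE by auto
    qed auto
    also have "(\<Sum>e\<in>E. (real_of_int (snd e))\<^sup>2) = (2 * real R + 1) * (real S * (real S + 1) * (2 * real S + 1) / 3)"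
    proof -
      have "(\<Sum>e\<in>E. (real_of_int (snd e))\<^sup>2) = (\<Sum>i\<in>{- int R..int R}. \<Sum>j\<in>{- int S..int S}. (real_of_int j)\<^sup>2)"
        unfolding E_def by (subst sum.cartesian_product) (auto intro: sum.cong)
      then show ?thesis unfolding sum_squares_interval by simp
    qed
    finally have "(\<Sum>c=0..<N. ?l c * ?j (q c))\<^sup>2 \<le> Mb\<^sup>2" using Mb(2) by linarith
    then have "\<bar>\<Sum>c=0..<N. ?l c * ?j (q c)\<bar> \<le> Mb" using Mb(1) abs_le_square_iff[of "\<Sum>c=0..<N. ?l c * ?j (q c)" Mb] by simp
    moreover have "(\<Sum>c=0..<N. ?l c * ?j (q c)) = of_int (\<Sum>c=0..<K*L. (int (c div K) - int h) * snd (pts (q c)))"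
      by (simp add: NKL)
    ultimately have "real_of_int \<bar>\<Sum>c=0..<K*L. (int (c div K) - int h) * snd (pts (q c))\<bar> \<le> Mb" by simp
    then have "\<bar>\<Sum>c=0..<K*L. (int (c div K) - int h) * snd (pts (q c))\<bar> \<le> \<lfloor>Mb\<rfloor>" by (simp add: le_floor_iff)
    then show ?thesis by linarith
  qed
  have "1 \<le> \<bar>fdet (K * L) (\<lambda>c t. (\<Prod>m<c mod K. z (pts t) - real m) / fact (c mod K) * u (pts t) powi (int (c div K) - int h))\<bar> * \<bar>of_int y\<bar> ^ nat \<lfloor>Mb\<rfloor>"
    unfolding z_def u_def \<gamma>_def
    by (rule fdet_lower_bound[OF \<sigma> n]) (use y Mbound det0 in \<open>auto simp: L_def NKL g_def z_def u_def \<gamma>_def\<close>)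
  then have lower: "1 \<le> \<bar>fdet N F\<bar> * of_int y ^ nat \<lfloor>Mb\<rfloor>" using y by (simp add: NKL F_def g_def)
  define Z where "Z = real p * W"
  have W0: "W > 0" using S by (simp add: W_def)
  have Z0: "Z > 0" using W0 p0 by (simp add: Z_def)
  have zZ: "\<bar>z (pts t)\<bar> \<le> Z" if t: "t < N" for t
  proof -
    obtain i j where ij: "pts t = (i, j)" by (cases "pts t")
    then have "\<bar>i\<bar> \<le> int R" "\<bar>j\<bar> \<le> int S" using ptsE[OF t] by (auto simp: E_def)
    then have "\<bar>real_of_int i\<bar> \<le> real R" "\<bar>real_of_int j\<bar> \<le> real S" by linarith+
    moreover have "\<bar>real_of_int r\<bar> \<le> real p / 2" using r(1) by linarith
    ultimately have "real p * \<bar>real_of_int i\<bar> + \<bar>real_of_int r\<bar> * \<bar>real_of_int j\<bar> \<le> real p * real R + real p / 2 * real S"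
      by (intro add_mono mult_mono) auto
    moreover have "\<bar>z (pts t)\<bar> \<le> real p * \<bar>real_of_int i\<bar> + \<bar>real_of_int r\<bar> * \<bar>real_of_int j\<bar>"
      unfolding ij z_def by (simp add: abs_mult order.trans[OF abs_triangle_ineq])
    ultimately show ?thesis by (simp add: Z_def W_def algebra_simps)
  qed
  define \<theta> where "\<theta> t = arccos (z (pts t) / Z)" for t
  have cos\<theta>: "Z * cos (\<theta> t) = z (pts t)" if "t < N" for t
    unfolding \<theta>_def using zZ[OF that] Z0 by (subst cos_arccos) (auto simp: field_simps abs_le_iff)
  define \<Lambda> where "\<Lambda> = real p * ln \<gamma> - of_int r * ln (eps\<^sup>2)"
  define l where "l c = real (c div K) - real h" for c
  define \<delta> where "\<delta> c t = l c * of_int (snd (pts t)) * \<Lambda> / real p" for c t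
  have lh: "\<bar>l c\<bar> \<le> real h" if "c < N" for c
  proof -
    have "c div K < L" using that by (simp add: NKL less_mult_imp_div_less mult.commute)
    then show ?thesis by (simp add: l_def L_def)
  qed
  have Feq: "F c t = inverse (fact (c mod K)) * ((\<Prod>m<c mod K. Z * cos (\<theta> t) - real m) * exp (l c * ln (eps\<^sup>2) / real p * (Z * cos (\<theta> t)) + \<delta> c t))"
    if t: "t < N" for c t
  proof -
    obtain i j where ij: "pts t = (i, j)" by (cases "pts t")
    have e2: "eps\<^sup>2 > 0" using w1 by linarith
    have zz: "z (pts t) = real p * of_int i + of_int r * of_int j" and sndp: "snd (pts t) = j" by (simp_all add: ij z_def)
    have u': "u (pts t) = eps\<^sup>2 powi i * \<gamma> powi j" by (simp add: ij u_def)
    have u0: "u (pts t) > 0" unfolding u' by (intro mult_pos_pos zero_less_power_int e2 \<gamma>)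
    have lnu: "ln (u (pts t)) = of_int i * ln (eps\<^sup>2) + of_int j * ln \<gamma>"
      unfolding u' ln_mult_pos[OF zero_less_power_int[OF e2] zero_less_power_int[OF \<gamma>]] ln_powi[OF e2] ln_powi[OF \<gamma>] ..
    have "u (pts t) powi (int (c div K) - int h) = exp (ln (u (pts t) powi (int (c div K) - int h)))" using u0 by simp
    also have "ln (u (pts t) powi (int (c div K) - int h)) = l c * ln (u (pts t))"
      using u0 by (simp add: ln_powi l_def)
    \<comment> \<open>Eliminating i between z = p i + r j and ln u = i ln eps^2 + j ln \<gamma>
      gives ln u = (ln eps^2 / p) z + j \<Lambda> / p.\<close>
    also have "\<dots> = l c * ln (eps\<^sup>2) / real p * z (pts t) + \<delta> c t"
      unfolding lnu \<delta>_def \<Lambda>_def zz sndp using p0 by (simp add: field_simps)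
    finally show ?thesis unfolding F_def g_def cos\<theta>[OF t] by (simp add: divide_inverse mult_ac)
  qed
  define b where "b c = \<bar>inverse (fact (c mod K))\<bar> * ((Z * cosh 2 + real K) ^ (c mod K) * (exp (\<bar>l c * ln (eps\<^sup>2) / real p\<bar> * (Z * cosh 2)) * (1 + 1 / real N)))" for c
  have cb: "cheb_bound 2 N \<theta> (\<lambda>t. inverse (fact (c mod K)) * ((\<Prod>m<c mod K. Z * cos (\<theta> t) - real m) * exp (l c * ln (eps\<^sup>2) / real p * (Z * cos (\<theta> t)) + \<delta> c t))) (b c)"
    if c: "c < N" for c
    unfolding b_def
  proof (intro cheb_bound.scale cheb_bound_falling cheb_bound_exp)
    show "Z \<ge> 0" "Z \<ge> 0" using Z0 by auto
    show "N > 0" by (rule N0)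
    show "c mod K \<le> K" using K by (simp add: less_imp_le)
    show "4 * (real h * real S * lam / real p) * real N * exp (real N * 2) \<le> 1" using C2 by (simp add: mult.commute)
    fix t assume t: "t < N"
    have "\<bar>snd (pts t)\<bar> \<le> int S" using ptsE[OF t] by (auto simp: E_def)
    then have "\<bar>real_of_int (snd (pts t))\<bar> \<le> real S" by linarith
    then have "\<bar>l c\<bar> * \<bar>real_of_int (snd (pts t))\<bar> * \<bar>\<Lambda>\<bar> \<le> real h * real S * lam"
      using lh[OF c] lam unfolding \<Lambda>_def by (intro mult_mono) auto
    then show "\<bar>\<delta> c t\<bar> \<le> real h * real S * lam / real p" unfolding \<delta>_def by (simp add: abs_mult divide_right_mono)
  qed simp
  have up: "\<bar>fdet N F\<bar> * exp (real N * (real N - 1)) \<le> fact N * 2 ^ N * (\<Prod>c<N. b c)"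
  proof -
    have "fdet N F = fdet N (\<lambda>c t. inverse (fact (c mod K)) * ((\<Prod>m<c mod K. Z * cos (\<theta> t) - real m) * exp (l c * ln (eps\<^sup>2) / real p * (Z * cos (\<theta> t)) + \<delta> c t)))"
      by (rule fdet_cong) (rule Feq)
    moreover have "\<bar>fdet N (\<lambda>c t. inverse (fact (c mod K)) * ((\<Prod>m<c mod K. Z * cos (\<theta> t) - real m) * exp (l c * ln (eps\<^sup>2) / real p * (Z * cos (\<theta> t)) + \<delta> c t)))\<bar>
      * exp (2 * (real N * (real N - 1) / 2)) \<le> fact N * 2 ^ N * (\<Prod>c<N. b c)"
      by (rule fdet_cheb_bound[where \<theta> = \<theta>]) (simp, erule cb)
    moreover have "2 * (real N * (real N - 1) / 2) = real N * (real N - 1)" by simp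
    ultimately show ?thesis by (simp only:)
  qed
  then have "\<bar>fdet N F\<bar> * of_int y ^ nat \<lfloor>Mb\<rfloor> * exp (real N * (real N - 1)) \<le> fact N * 2 ^ N * (\<Prod>c<N. b c) * of_int y ^ nat \<lfloor>Mb\<rfloor>"
    using y mult_right_mono[OF up, of "of_int y ^ nat \<lfloor>Mb\<rfloor>"] by (simp add: mult_ac)
  then have "1 * exp (real N * (real N - 1)) \<le> fact N * 2 ^ N * (\<Prod>c<N. b c) * of_int y ^ nat \<lfloor>Mb\<rfloor>"
    using mult_right_mono[OF lower exp_ge_zero[of "real N * (real N - 1)"]] by linarith
  then have big: "exp (real N * (real N - 1)) \<le> fact N * 2 ^ N * (\<Prod>c<N. b c) * of_int y ^ nat \<lfloor>Mb\<rfloor>" by simp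
  have bpos: "b c > 0" for c
  proof -
    have "Z * cosh 2 + real K > 0" using Z0 by (intro add_pos_nonneg) auto
    moreover have "1 + 1 / real N > 0" using N0 by (intro add_pos_nonneg) auto
    ultimately show ?thesis unfolding b_def by (intro mult_pos_pos) auto
  qed
  then have Ppos: "(\<Prod>c<N. b c) > 0" by (intro prod_pos) auto
  have "real N * (real N - 1) \<le> ln (fact N * 2 ^ N * (\<Prod>c<N. b c) * of_int y ^ nat \<lfloor>Mb\<rfloor>)"
  proof (subst ln_ge_iff)
    show "0 < fact N * 2 ^ N * (\<Prod>c<N. b c) * real_of_int y ^ nat \<lfloor>Mb\<rfloor>"
      using Ppos y by (intro mult_pos_pos) auto
  qed (rule big)
  also have "\<dots> = ln (fact N) + real N * ln 2 + ln (\<Prod>c<N. b c) + real (nat \<lfloor>Mb\<rfloor>) * ln (of_int y)"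
    using Ppos y by (simp add: ln_mult_pos ln_realpow)
  also have "ln (fact N :: real) \<le> real N * ln (real N)"
  proof -
    have "ln (fact N :: real) \<le> ln (real N ^ N)" using N0 fact_le_power[of N] by (subst ln_le_cancel_iff) auto
    then show ?thesis using N0 by (simp add: ln_realpow)
  qed
  also have "real (nat \<lfloor>Mb\<rfloor>) * ln (of_int y) \<le> Mb * ln (of_int y)" using Mb(1) y by (intro mult_right_mono) auto
  also have "ln (\<Prod>c<N. b c) = (\<Sum>c<N. ln (b c))" using bpos by (intro ln_prod) (auto, metis less_irrefl)
  also have "(\<Sum>c<N. ln (b c)) = real L * (\<Sum>k<K. real k * ln (Z * cosh 2 + real K) - ln (fact k)) + real K * (\<Sum>l<L. \<bar>real l - real h\<bar> * (ln (eps\<^sup>2) * W * cosh 2) + ln (1 + 1 / real N))"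
  proof -
    have "ln (b c) = (real (c mod K) * ln (Z * cosh 2 + real K) - ln (fact (c mod K))) + (\<bar>real (c div K) - real h\<bar> * (ln (eps\<^sup>2) * W * cosh 2) + ln (1 + 1 / real N))" for c
    proof -
      have q: "Z * cosh 2 + real K > 0" using Z0 by (intro add_pos_nonneg) auto
      have q2: "1 + 1 / real N > 0" using N0 by (intro add_pos_nonneg) auto
      have "\<bar>l c * ln (eps\<^sup>2) / real p\<bar> * (Z * cosh 2) = \<bar>l c\<bar> * (ln (eps\<^sup>2) * W * cosh 2)"
        using w1 p0 unfolding Z_def by (simp add: abs_mult field_simps)
      then show ?thesis unfolding b_def using q q2 by (simp add: ln_mult_pos ln_realpow ln_inverse l_def)
    qed
    then show ?thesis using sum_mod_div[OF K, where L = L and \<phi> = "\<lambda>k. real k * ln (Z * cosh 2 + real K) - ln (fact k)" and \<psi> = "\<lambda>l. \<bar>real l - real h\<bar> * (ln (eps\<^sup>2) * W * cosh 2) + ln (1 + 1 / real N)"] by (simp add: NKL[symmetric])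
  qed
  finally have 1: "real N * (real N - 1) \<le> real N * ln (real N) + real N * ln 2 + (real L * (\<Sum>k<K. real k * ln (Z * cosh 2 + real K) - ln (fact k)) + real K * (\<Sum>l<L. \<bar>real l - real h\<bar> * (ln (eps\<^sup>2) * W * cosh 2) + ln (1 + 1 / real N))) + Mb * ln (of_int y)"
    by simp
  have 2: "(\<Sum>l<L. \<bar>real l - real h\<bar> * (ln (eps\<^sup>2) * W * cosh 2) + ln (1 + 1 / real N)) = real h * (real h + 1) * (ln (eps\<^sup>2) * W * cosh 2) + real L * ln (1 + 1 / real N)"
    using sum_centered(1)[of h] by (simp add: sum.distrib sum_distrib_right[symmetric] L_def)
  have 3: "real N * ln (1 + 1 / real N) \<le> 1"
  proof -
    have "ln (1 + 1 / real N) \<le> 1 / real N" by (rule ln_add_one_self_le_self) simp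
    then show ?thesis using N0 by (simp add: field_simps)
  qed
  have 4: "(\<Sum>k<K. real k * ln (Z * cosh 2 + real K) - ln (fact k)) \<le> real K * (real K - 1) / 2 * ln (Z * cosh 2 / real K + 1) + 3 / 4 * (real K)\<^sup>2"
  proof -
    have "(\<Sum>k<K. real k) = real K * (real K - 1) / 2" by (induction K) (auto simp: field_simps)
    then have "(\<Sum>k<K. real k * ln (Z * cosh 2 + real K) - ln (fact k)) = real K * (real K - 1) / 2 * ln (Z * cosh 2 + real K) - (\<Sum>k<K. ln (fact k))"
      by (simp add: sum_subtractf sum_distrib_right[symmetric])
    moreover have "ln (Z * cosh 2 / real K + 1) = ln (Z * cosh 2 + real K) - ln (real K)"
    proof -
      have "Z * cosh 2 / real K + 1 = (Z * cosh 2 + real K) / real K" using K by (simp add: field_simps)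
      moreover have "Z * cosh 2 + real K > 0" using Z0 by (intro add_pos_nonneg) auto
      ultimately show ?thesis using K by (simp add: ln_div)
    qed
    ultimately show ?thesis using sum_ln_fact_ge[OF K] by (simp add: right_diff_distrib)
  qed
  have 5: "real N * ln (real N) + real N * ln 2 = real N * ln (2 * real N)"
    using N0 by (simp add: ln_mult_pos algebra_simps)
  have "real L * (\<Sum>k<K. real k * ln (Z * cosh 2 + real K) - ln (fact k)) \<le> real L * (real K * (real K - 1) / 2 * ln (Z * cosh 2 / real K + 1) + 3 / 4 * (real K)\<^sup>2)"
    using 4 by (intro mult_left_mono) auto
  moreover have "real K * (real L * ln (1 + 1 / real N)) \<le> 1" using 3 by (simp add: NKL mult.assoc)
  ultimately have "real N * (real N - 1) \<le> real N * ln (2 * real N) + real L * (real K * (real K - 1) / 2 * ln (Z * cosh 2 / real K + 1) + 3 / 4 * (real K)\<^sup>2) + (real K * (real h * (real h + 1) * (ln (eps\<^sup>2) * W * cosh 2)) + 1) + Mb * ln (of_int y)"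
    using 1 unfolding 2 5[symmetric] distrib_left by linarith
  then show False using C3 unfolding Z_def[symmetric] L_def[symmetric] by (simp add: algebra_simps)
qed

subsection \<open>The linear form attached to a solution\<close>

text \<open>This is the case r = 0. Then \<alpha> has irrational part at least 1, so \<alpha>^p -
  \<alpha>'^p >= (\<alpha> - \<alpha>') \<alpha>^(p - 1) > 2 sqrt 2, whereas the difference is
  exactly 2 sqrt 2.\<close>

lemma exponent_nonzero:
  assumes eq: "of_int x + sqrt 2 = zval \<alpha> ^ p" "of_int x - sqrt 2 = zval (zconj \<alpha>) ^ p"
    and p: "odd p" "p > 1" and x: "x > 1" and y: "zval \<alpha> * zval (zconj \<alpha>) > 1"
  shows False
proof -
  define a a' where "a = zval \<alpha>" and "a' = zval (zconj \<alpha>)"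
  have s2: "sqrt 2 < 2" by (rule real_less_lsqrt) auto
  have x2: "real_of_int x \<ge> 2" using x by linarith
  have "sqrt 2 > 0" by simp
  then have "of_int x + sqrt 2 > 0" "of_int x - sqrt 2 > 0" using s2 x2 by linarith+
  then have "a ^ p > 0" "a' ^ p > 0" using eq by (simp_all add: a_def a'_def)
  then have a0: "a > 0" "a' > 0" using p by (auto simp: zero_less_power_eq)
  have df: "a ^ p - a' ^ p = 2 * sqrt 2" using eq by (simp add: a_def a'_def)
  have "a > a'"
  proof (rule ccontr)
    assume "\<not> a > a'"
    then have "a ^ p \<le> a' ^ p" using a0 by (intro power_mono) auto
    then show False using df \<open>sqrt 2 > 0\<close> by linarith
  qed
  have a1: "a > 1"
  proof (rule ccontr)
    assume "\<not> a > 1"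
    then have "a * a' \<le> 1 * 1" using a0 \<open>a > a'\<close> by (intro mult_mono) auto
    then show False using y by (simp add: a_def a'_def)
  qed
  have d: "a - a' = 2 * of_int (irr_part \<alpha>) * sqrt 2" by (simp add: a_def a'_def zval_def zconj_def)
  then have "0 < 2 * real_of_int (irr_part \<alpha>) * sqrt 2" using \<open>a > a'\<close> by linarith
  then have "irr_part \<alpha> > 0" by (simp add: zero_less_mult_iff)
  then have "real_of_int (irr_part \<alpha>) \<ge> 1" by linarith
  then have d2: "a - a' \<ge> 2 * sqrt 2" unfolding d by simp
  have "a ^ (p - 1) > 1" using a1 p by (intro one_less_power) auto
  then have "(a - a') * a ^ (p - 1) > (a - a') * 1" using \<open>a > a'\<close> by (intro mult_strict_left_mono) auto
  moreover have "(a - a') * a ^ (p - 1) \<le> a ^ p - a' ^ p"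
  proof -
    have "a' ^ (p - 1) \<le> a ^ (p - 1)" using a0 \<open>a > a'\<close> by (intro power_mono) auto
    then have "a' * a' ^ (p - 1) \<le> a' * a ^ (p - 1)" using a0 by (intro mult_left_mono) auto
    moreover have "a ^ p = a * a ^ (p - 1)" "a' ^ p = a' * a' ^ (p - 1)" using p by (simp_all flip: power_Suc)
    ultimately show ?thesis by (simp add: left_diff_distrib)
  qed
  ultimately have "(a - a') * 1 < a ^ p - a' ^ p" by (rule less_le_trans)
  then show False unfolding df using d2 by simp
qed

text \<open>Dividing the conjugate factorizations gives \<gamma>^p = eps^(2 r) (x - sqrt 2) / (x +
  sqrt 2), and the last quotient is close to 1 because x >= y^(p / 2). The sign \<sigma> of the norm
  makes \<gamma> positive.\<close>

lemma solution_linear_form: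
  fixes x y :: int and p :: nat
  assumes eq: "x\<^sup>2 - 2 = y ^ p" and p: "odd p" "p > 1" and x: "x > 0" and y: "y \<ge> 7"
  shows "\<exists>\<alpha> r \<sigma>. (\<sigma> = 1 \<or> \<sigma> = -1) \<and> zval \<alpha> * zval (zconj \<alpha>) = of_int (\<sigma> * y) \<and>
    of_int \<sigma> * zval (zconj \<alpha>) / zval \<alpha> > 0 \<and> 2 * \<bar>r\<bar> < int p \<and> r \<noteq> 0 \<and>
    \<bar>real p * ln (of_int \<sigma> * zval (zconj \<alpha>) / zval \<alpha>) - of_int r * ln (eps\<^sup>2)\<bar> \<le> 6 * exp (- (real p / 2 * ln (of_int y)))"
proof -
  obtain \<alpha> r where r: "2 * \<bar>r\<bar> < int p" and n: "\<bar>znorm \<alpha>\<bar> = \<bar>y\<bar>"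
    and f: "of_int x + sqrt 2 = eps powi r * zval \<alpha> ^ p" "of_int x - sqrt 2 = eps' powi r * zval (zconj \<alpha>) ^ p"
    using sqrt2_factorization[OF eq p(1)] y by auto
  define a a' where "a = zval \<alpha>" and "a' = zval (zconj \<alpha>)"
  define \<sigma> :: int where "\<sigma> = (if znorm \<alpha> > 0 then 1 else -1)"
  have \<sigma>: "\<sigma> = 1 \<or> \<sigma> = -1" by (simp add: \<sigma>_def)
  have "znorm \<alpha> = \<sigma> * y" using n y by (auto simp: \<sigma>_def abs_if split: if_splits)
  then have aa: "a * a' = of_int (\<sigma> * y)" by (simp add: a_def a'_def zval_mult_zconj)
  have ypow: "(7::real) ^ 2 \<le> of_int y ^ p"
  proof -
    have "(7::real) ^ 2 \<le> of_int y ^ 2" using y by (intro power_mono) auto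
    also have "\<dots> \<le> of_int y ^ p" using y p(2) by (intro power_increasing) auto
    finally show ?thesis .
  qed
  have xr: "(of_int x)\<^sup>2 = of_int y ^ p + (2::real)"
  proof -
    have "real_of_int (x\<^sup>2 - 2) = real_of_int (y ^ p)" using eq by simp
    then show ?thesis by simp
  qed
  have s2: "sqrt 2 < 2" "sqrt 2 > 1" by (rule real_less_lsqrt) auto
  define s where "s = sqrt (of_int y ^ p :: real)"
  have s7: "s \<ge> 7" unfolding s_def using ypow real_sqrt_le_mono[OF ypow] by simp
  have "s\<^sup>2 \<le> (of_int x)\<^sup>2" using xr y by (simp add: s_def)
  then have xs: "of_int x \<ge> s" by (rule power2_le_imp_le) (use x in simp)
  define Xp Xm where "Xp = of_int x + sqrt 2" and "Xm = of_int x - sqrt 2"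
  have Xm: "Xm \<ge> s / 2" "Xm > 0" "Xp > 0" using xs s7 s2 unfolding Xm_def Xp_def by linarith+
  have e0: "eps \<noteq> 0" "eps' \<noteq> 0" using eps_mult by auto
  have m1: "(-1::real) powi r = 1 \<or> (-1::real) powi r = -1" by (auto simp: power_int_minus_left)
  \<comment> \<open>Norms of the factorization: y^p is positive, eps has norm -1, and p is
    odd.\<close>
  have s1: "of_int \<sigma> = ((-1) powi r :: real)"
  proof -
    have "Xp * Xm = of_int y ^ p" using xr by (simp add: Xp_def Xm_def algebra_simps power2_eq_square)
    moreover have "Xp * Xm = (eps * eps') powi r * (a * a') ^ p"
      unfolding Xp_def Xm_def f by (simp add: a_def a'_def power_mult_distrib power_int_mult_distrib)
    ultimately have "(-1) powi r * (of_int \<sigma> * of_int y) ^ p = (of_int y ^ p :: real)" unfolding eps_mult aa by simp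
    then have "(-1) powi r * (of_int \<sigma> :: real) * of_int y ^ p = of_int y ^ p" using \<sigma> p(1) by (auto simp: power_mult_distrib)
    moreover have "(of_int y ^ p :: real) \<noteq> 0" using y by simp
    ultimately have "(-1) powi r * (of_int \<sigma> :: real) = 1" using mult_cancel_right2 by blast
    then show ?thesis using m1 by auto
  qed
  define \<gamma> where "\<gamma> = of_int \<sigma> * a' / a"
  have "eps powi r = of_int \<sigma> * eps\<^sup>2 powi r * eps' powi r"
  proof -
    have "eps = (-1) * eps\<^sup>2 * eps'" using eps_mult by (simp add: power2_eq_square mult.assoc)
    then have "eps powi r = ((-1) * eps\<^sup>2 * eps') powi r" by simp
    then show ?thesis unfolding s1 by (simp only: power_int_mult_distrib)
  qed
  note er = this
  have \<gamma>p: "\<gamma> ^ p = eps\<^sup>2 powi r * (Xm / Xp)"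
  proof -
    have "\<gamma> ^ p = of_int \<sigma> * (a' ^ p / a ^ p)" unfolding \<gamma>_def using \<sigma> p(1) by (auto simp: power_divide)
    moreover have "a ^ p = Xp / eps powi r" "a' ^ p = Xm / eps' powi r" using f e0 by (auto simp: Xp_def Xm_def a_def a'_def)
    ultimately have "\<gamma> ^ p = of_int \<sigma> * (Xm / Xp) * (eps powi r / eps' powi r)" by (simp add: field_simps)
    also have "eps powi r / eps' powi r = of_int \<sigma> * eps\<^sup>2 powi r" unfolding er using e0 by simp
    finally show ?thesis using \<sigma> by auto
  qed
  have e2: "eps\<^sup>2 > 0" using e0 by simp
  have pos: "eps\<^sup>2 powi r > 0" using e2 by (rule zero_less_power_int)
  have "\<gamma> ^ p > 0" unfolding \<gamma>p using pos Xm by (intro mult_pos_pos divide_pos_pos)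
  then have \<gamma>: "\<gamma> > 0" using p by (simp add: zero_less_power_eq)
  have "real p * ln \<gamma> = ln (\<gamma> ^ p)" using \<gamma> by (simp add: ln_realpow)
  also have "\<dots> = ln (eps\<^sup>2 powi r) + ln (Xm / Xp)" unfolding \<gamma>p using pos Xm by (intro ln_mult_pos divide_pos_pos) auto
  also have "ln (eps\<^sup>2 powi r) = of_int r * ln (eps\<^sup>2)"
    using e2 by (cases "r \<ge> 0") (auto simp: power_int_def ln_realpow ln_inverse power_inverse)
  finally have L: "real p * ln \<gamma> - of_int r * ln (eps\<^sup>2) = ln (Xm / Xp)" by simp
  have "\<bar>ln (Xm / Xp)\<bar> \<le> 6 / s"
  proof -
    have "ln (Xm / Xp) = - ln (1 + 2 * sqrt 2 / Xm)"
    proof -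
      have "1 + 2 * sqrt 2 / Xm = inverse (Xm / Xp)" using Xm by (simp add: Xm_def Xp_def field_simps)
      moreover have "ln (inverse (Xm / Xp)) = - ln (Xm / Xp)" using Xm by (intro ln_inverse divide_pos_pos)
      ultimately show ?thesis by simp
    qed
    moreover have "ln (1 + 2 * sqrt 2 / Xm) \<le> 2 * sqrt 2 / Xm" using Xm by (intro ln_add_one_self_le_self) auto
    moreover have "ln (1 + 2 * sqrt 2 / Xm) \<ge> 0" using Xm by simp
    moreover have "2 * sqrt 2 / Xm \<le> 2 * sqrt 2 / (s / 2)" using Xm s7 by (intro divide_left_mono) auto
    moreover have "2 * sqrt 2 / (s / 2) \<le> 6 / s"
    proof -
      have "sqrt 2 \<le> 3 / 2" by (rule real_le_lsqrt) (auto simp: power2_eq_square)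
      then show ?thesis using s7 by (simp add: divide_right_mono)
    qed
    ultimately show ?thesis by linarith
  qed
  moreover have "6 / s = 6 * exp (- (real p / 2 * ln (of_int y)))"
  proof -
    have "exp (real p / 2 * ln (of_int y)) = s"
    proof (rule power2_eq_imp_eq)
      have "(exp (real p / 2 * ln (of_int y)))\<^sup>2 = exp (real p * ln (of_int y))" by (simp add: exp_double[symmetric])
      then show "(exp (real p / 2 * ln (of_int y)))\<^sup>2 = s\<^sup>2" using y by (simp add: s_def exp_of_nat_mult)
    qed (use s7 in auto)
    then show ?thesis by (simp only: exp_minus divide_inverse)
  qed
  ultimately have lam: "\<bar>real p * ln \<gamma> - of_int r * ln (eps\<^sup>2)\<bar> \<le> 6 * exp (- (real p / 2 * ln (of_int y)))" unfolding L by simp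
  have "r \<noteq> 0"
  proof
    assume r0: "r = 0"
    then have "\<sigma> = 1" using s1 by simp
    then have "zval \<alpha> * zval (zconj \<alpha>) > 1" using aa y by (simp add: a_def a'_def)
    moreover have "x > 1" using xs s7 by linarith
    ultimately show False using exponent_nonzero[of x \<alpha> p] f r0 p by simp
  qed
  then show ?thesis using \<sigma> aa \<gamma> r lam unfolding \<gamma>_def a_def a'_def by blast
qed

subsection \<open>The base 7\<close>

text \<open>With \<open>pell7x n\<close> as rational part, the coefficient of \<surd>7 in (3 +
  \<surd>7) (8 + 3 \<surd>7)^n; the recurrence comes from trace 16 and norm 1 of 8 + 3
  \<surd>7.\<close>

fun pell7 :: "nat \<Rightarrow> int" where
  "pell7 0 = 1"
| "pell7 (Suc 0) = 17"
| "pell7 (Suc (Suc n)) = 16 * pell7 (Suc n) - pell7 n"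

fun pell7x :: "nat \<Rightarrow> int" where
  "pell7x 0 = 3"
| "pell7x (Suc 0) = 45"
| "pell7x (Suc (Suc n)) = 16 * pell7x (Suc n) - pell7x n"

lemma pell7_step: "pell7x (Suc n) = 8 * pell7x n + 21 * pell7 n \<and> pell7 (Suc n) = 3 * pell7x n + 8 * pell7 n"
  by (induction n) auto

text \<open>Descent by multiplication with 8 - 3 \<surd>7, down to the solution (3, 1).\<close>

lemma pell7_solutions:
  assumes "X > 0" "Y > 0" "X\<^sup>2 - 7 * Y\<^sup>2 = (2::int)"
  shows "\<exists>n. X = pell7x n \<and> Y = pell7 n"
  using assms
proof (induction "nat Y" arbitrary: X Y rule: less_induct)
  case less
  show ?case
  proof (cases "Y \<le> 1")
    case True
    then have "Y = 1" using less.prems by simp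
    then have "X\<^sup>2 = 3\<^sup>2" using less.prems by simp
    then have "X = 3" using less.prems(1) power2_eq_imp_eq[of X 3] by simp
    then show ?thesis using \<open>Y = 1\<close> by (intro exI[of _ 0]) simp
  next
    case False
    let ?X = "8 * X - 21 * Y" and ?Y = "8 * Y - 3 * X"
    have e: "X\<^sup>2 = 7 * Y\<^sup>2 + 2" using less.prems by simp
    \<comment> \<open>The new Y is positive only if Y^2 > 18, so 2, 3 and 4 are excluded by
      hand.\<close>
    have "\<not> Y \<le> 4"
    proof
      assume Y4: "Y \<le> 4"
      then have "Y\<^sup>2 \<le> 4\<^sup>2" using False by (intro power_mono) auto
      then have "X\<^sup>2 < 11\<^sup>2" using e by simp
      then have "X < 11" by (rule power_less_imp_less_base) simp
      then have "X \<in> {1,2,3,4,5,6,7,8,9,10}" using less.prems(1) by (simp, presburger)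
      moreover have "Y \<in> {2,3,4}" using Y4 False by auto
      ultimately show False using e by auto
    qed
    then have Y2: "Y\<^sup>2 \<ge> 25" using power_mono[of 5 Y 2] by simp
    have "(3 * X)\<^sup>2 < (8 * Y)\<^sup>2" using e Y2 by (simp add: power_mult_distrib)
    then have 1: "3 * X < 8 * Y" by (rule power_less_imp_less_base) (use False in simp)
    have "(7 * Y)\<^sup>2 < (3 * X)\<^sup>2" using e Y2 by (simp add: power_mult_distrib)
    then have 2: "7 * Y < 3 * X" by (rule power_less_imp_less_base) (use less.prems in simp)
    have "(21 * Y)\<^sup>2 < (8 * X)\<^sup>2" using e Y2 by (simp add: power_mult_distrib)
    then have 3: "21 * Y < 8 * X" by (rule power_less_imp_less_base) (use less.prems in simp)
    have "?X\<^sup>2 - 7 * ?Y\<^sup>2 = X\<^sup>2 - 7 * Y\<^sup>2" by (simp add: power2_eq_square algebra_simps)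
    then obtain n where "?X = pell7x n" "?Y = pell7 n"
      using less.hyps[of ?Y ?X] 1 2 3 less.prems by auto
    then have "X = pell7x (Suc n) \<and> Y = pell7 (Suc n)" using pell7_step[of n] by simp
    then show ?thesis by blast
  qed
qed

text \<open>The modulus is \<open>pell7 3 = 7 * 617\<close>.\<close>

lemma pell7_periodic: "4319 dvd pell7 (n + 7) - pell7 n"
proof -
  have "4319 dvd pell7 (n + 7) - pell7 n \<and> 4319 dvd pell7 (Suc n + 7) - pell7 (Suc n)"
  proof (induction n)
    case 0
    have "pell7 7 = 278635967" "pell7 8 = 4440692161" by (simp_all add: numeral_eq_Suc)
    then show ?case by simp
  next
    case (Suc n)
    have "pell7 (Suc (Suc n) + 7) - pell7 (Suc (Suc n)) =
      16 * (pell7 (Suc n + 7) - pell7 (Suc n)) - (pell7 (n + 7) - pell7 n)"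
      unfolding add_Suc pell7.simps(3)[of "n + 7"] pell7.simps(3)[of n]
      by (simp del: pell7.simps add: algebra_simps)
    then have "4319 dvd pell7 (Suc (Suc n) + 7) - pell7 (Suc (Suc n))" using Suc by (simp only: dvd_diff dvd_mult)
    then show ?case using Suc by blast
  qed
  then show ?thesis by blast
qed

text \<open>Among the indices 0 to 6 only 3 gives a multiple of 7, and that value is 7 * 617. The
  period 7 reflects two symmetries: the sequence, continued backwards, is odd about -1/2, and modulo
  its value at 3 it is also odd about 3.\<close>

lemma pell7_dvd: "7 dvd pell7 n \<Longrightarrow> 617 dvd pell7 n"
proof (induction n rule: less_induct)
  case (less n)
  show ?case
  proof (cases "n < 7")
    case True
    then have "n \<in> {0,1,2,3,4,5,6}" by auto
    then show ?thesis using less.prems by (auto simp: eval_nat_numeral)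
  next
    case False
    then obtain m where m: "n = m + 7" using le_Suc_ex[of 7 n] by (auto simp: add.commute)
    have "(4319::int) = 7 * 617" by simp
    then have a: "7 dvd pell7 n - pell7 m" "617 dvd pell7 n - pell7 m"
      using pell7_periodic[of m] m by (metis dvd_mult_left dvd_mult_right)+
    then have "7 dvd pell7 m" using less.prems by (metis dvd_diff_right_iff)
    then have "617 dvd pell7 m" using less.IH m by simp
    then show ?thesis using a(2) by (metis dvd_diff_left_iff)
  qed
qed

text \<open>For p = 2 k + 1 the equation is x^2 - 7 (7^k)^2 = 2, so the power 7^k would have to be
  divisible by 617.\<close>

lemma no_solution_base_7:
  fixes x :: int
  assumes "odd p" "p > 1"
  shows "x\<^sup>2 - 2 \<noteq> 7 ^ p"
proof
  assume eq: "x\<^sup>2 - 2 = 7 ^ p"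
  obtain k where k: "p = 2 * k + 1" using assms(1) by (auto elim: oddE)
  have k0: "k > 0" using k assms by simp
  have "(7::int) ^ p = 7 * (7 ^ k)\<^sup>2" unfolding k power_add power_mult[symmetric] by (simp add: mult.commute)
  then have "\<bar>x\<bar>\<^sup>2 - 7 * (7 ^ k)\<^sup>2 = 2" using eq by simp
  moreover have "\<bar>x\<bar> > 0"
  proof -
    have "x \<noteq> 0"
    proof
      assume "x = 0"
      then have "(7::int) ^ p = -2" using eq by simp
      moreover have "(7::int) ^ p > 0" by simp
      ultimately show False by linarith
    qed
    then show ?thesis by simp
  qed
  ultimately obtain n where "7 ^ k = pell7 n" using pell7_solutions[of "\<bar>x\<bar>" "7 ^ k"] by auto
  then have "(617::int) dvd 7 ^ k" using pell7_dvd[of n] k0 by (metis dvd_power)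
  moreover have "coprime (617::int) (7 ^ k)"
  proof -
    have "coprime (617::int) 7" by (simp add: coprime_iff_gcd_eq_1 gcd_non_0_int)
    then show ?thesis by simp
  qed
  ultimately have "is_unit (617::int)" by (metis coprime_absorb_left)
  then show False by simp
qed

subsection \<open>Choice of parameters\<close>

lemma exp_ge_partial_sum: "x \<ge> 0 \<Longrightarrow> (\<Sum>n<m. x ^ n / fact n) \<le> exp (x :: real)"
proof -
  assume "x \<ge> 0"
  then have "(\<Sum>n<m. x ^ n /\<^sub>R fact n) \<le> exp x"
    unfolding exp_def by (intro sum_le_suminf summable_exp_generic) auto
  then show ?thesis by (simp add: divide_inverse mult.commute)
qed

lemma exp_1_bounds: "27/10 \<le> exp (1::real)" "exp (1::real) \<le> 27187/10000"
proof -
  have "(\<Sum>n<6. 1 ^ n / fact n) \<le> exp (1 :: real)" by (rule exp_ge_partial_sum) simp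
  then show "27/10 \<le> exp (1::real)" by (simp add: eval_nat_numeral)
  obtain t :: real where t: "\<bar>t\<bar> \<le> \<bar>1\<bar>" "exp 1 = (\<Sum>m<7. 1 ^ m / fact m) + exp t / fact 7 * 1 ^ 7"
    using Maclaurin_exp_le[of 1 7] by auto
  have "exp t \<le> exp 1" using t(1) by simp
  then have "exp t \<le> 3" using exp_le by linarith
  then have "exp t / fact 7 \<le> 3 / fact 7" by (intro divide_right_mono) auto
  then show "exp (1::real) \<le> 27187/10000" using t(2) by (simp add: eval_nat_numeral)
qed

lemma exp_real_of_nat: "exp (real n) = exp 1 ^ n" by (metis exp_of_nat_mult mult.right_neutral)

lemma cosh_2_le: "cosh (2::real) \<le> 377/100"
proof -
  have e: "exp (2::real) = (exp 1)\<^sup>2" using exp_real_of_nat[of 2] by simp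
  have "(exp (1::real))\<^sup>2 \<le> (27187/10000)\<^sup>2" "(27/10)\<^sup>2 \<le> (exp (1::real))\<^sup>2"
    using exp_1_bounds by (auto intro!: power_mono)
  moreover have "exp (- (2::real)) \<le> 1 / (27/10)\<^sup>2"
    unfolding exp_minus e inverse_eq_divide using calculation(2) by (intro divide_left_mono) auto
  ultimately show ?thesis unfolding cosh_def e by (simp add: power2_eq_square)
qed

lemma ln_eps_sq_le: "ln (eps\<^sup>2) \<le> 177/100"
proof -
  have "(\<Sum>n<7. (177/100) ^ n / fact n) \<le> exp (177/100 :: real)" by (rule exp_ge_partial_sum) simp
  then have "exp (177/100 :: real) \<ge> 584/100" by (simp add: eval_nat_numeral)
  moreover have "eps\<^sup>2 \<le> 584/100"
  proof -
    have "sqrt 2 \<le> 1415/1000" by (rule real_le_lsqrt) (auto simp: power2_eq_square)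
    then show ?thesis by (simp add: power2_eq_square algebra_simps)
  qed
  moreover have "eps > 0" by (simp add: add_pos_nonneg)
  ultimately have "ln (eps\<^sup>2) \<le> ln (exp (177/100))" by (subst ln_le_cancel_iff) auto
  then show ?thesis by simp
qed

text \<open>The tangent at \<open>exp a\<close>; linear majorants keep the final inequalities
  linear. The tangent at e^4 suits s = 30 and s = 46.2, the values of the parameter \<open>s\<close>
  when L = 9, and the one at e^8 suits 2 N near 3000.\<close>

lemma ln_le_tangent:
  assumes "t > 0"
  shows "ln t \<le> t / exp a + a - (1::real)"
proof -
  have "ln (t * exp (- a)) \<le> t * exp (- a) - 1" using assms by (intro ln_le_minus_one) auto
  moreover have "ln (t * exp (- a)) = ln t - a" using assms by (simp add: ln_mult_pos)
  ultimately show ?thesis by (simp add: exp_minus divide_inverse)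
qed

lemma ln_le_div_53: "t > 0 \<Longrightarrow> ln t \<le> t / 53 + (3::real)"
proof -
  assume t: "t > 0"
  have "(53::real) \<le> (27/10) ^ 4" by (simp add: power_divide)
  also have "\<dots> \<le> exp 1 ^ 4" using exp_1_bounds by (intro power_mono) auto
  also have "\<dots> = exp 4" using exp_real_of_nat[of 4] by simp
  finally have "exp (4::real) \<ge> 53" .
  then have "t / exp 4 \<le> t / 53" using t by (intro divide_left_mono) auto
  then show ?thesis using ln_le_tangent[OF t, of 4] by linarith
qed

lemma ln_le_div_2800: "t > 0 \<Longrightarrow> ln t \<le> t / 2800 + (7::real)"
proof -
  assume t: "t > 0"
  have "(2800::real) \<le> (27/10) ^ 8" by (simp add: power_divide)
  also have "\<dots> \<le> exp 1 ^ 8" using exp_1_bounds by (intro power_mono) auto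
  also have "\<dots> = exp 8" using exp_real_of_nat[of 8] by simp
  finally have "exp (8::real) \<ge> 2800" .
  then have "t / exp 8 \<le> t / 2800" using t by (intro divide_left_mono) auto
  then show ?thesis using ln_le_tangent[OF t, of 8] by linarith
qed

text \<open>
  The grid has \<open>5 L\<close> values of \<open>j\<close> and about \<open>K / 5 + L\<close> values of \<open>i\<close>, where \<open>L = 2 h + 1\<close>;
  the Chebyshev parameter is \<open>\<mu> = 2\<close>.
\<close>

lemma no_solution_of_parameters:
  fixes x y :: int and p h K :: nat and s :: real
  assumes eq: "x\<^sup>2 - 2 = y ^ p" and p: "prime p" "odd p" and x: "x > 0" and y: "y \<ge> 7"
  defines "L \<equiv> 2 * real h + 1" and "v \<equiv> ln (real_of_int y)"
  assumes h: "h \<ge> 4" and hp: "10 * (h * (5 * h + 2)) \<le> p"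
    and K: "real K \<ge> 37/2 * L"
    and size: "3 * (real K * L) * exp (2 * (real K * L)) \<le> exp (real p / 2 * v)"
    and s: "s > 0" "real p * (1/10 + 7/4 * L / real K) * (377/100) + 1 \<le> s\<^sup>2"
    and main: "s / 53 + 3 + 3/4 + 167/100 * L * (1/10 + 7/4 * L / real K) + 475/1000 * L\<^sup>2 * v / real K + 7/1000 * L \<le> L"
  shows False
proof -
  obtain \<alpha> r \<sigma> where sol: "\<sigma> = 1 \<or> \<sigma> = -1" "zval \<alpha> * zval (zconj \<alpha>) = of_int (\<sigma> * y)"
    "of_int \<sigma> * zval (zconj \<alpha>) / zval \<alpha> > 0" "2 * \<bar>r\<bar> < int p" "r \<noteq> 0"
    "\<bar>real p * ln (of_int \<sigma> * zval (zconj \<alpha>) / zval \<alpha>) - of_int r * ln (eps\<^sup>2)\<bar> \<le> 6 * exp (- (real p / 2 * v))"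
    using solution_linear_form[OF eq p(2) prime_gt_1_nat[OF p(1)] x y] unfolding v_def by blast
  \<comment> \<open>Now 2 S + 1 = 5 L, and \<open>R2\<close> is K / 5 rounded up, so the short grid
    has at least K L points. \<open>R\<close> makes room for the 2 h = L - 1 additional values of
    i.\<close>
  define S where "S = 5 * h + 2"
  define R2 where "R2 = (K + 4) div 5"
  define R where "R = (R2 + 2 * h) div 2"
  define N where "N = real K * L"
  define W where "W = real R + real S / 2"
  define k where "k = real K"
  have L9: "L \<ge> 9" using h by (simp add: L_def)
  have k166: "k \<ge> 333/2" using K L9 by (simp add: k_def)
  have N1: "N \<ge> 37/2 * 81"
  proof -
    have "(37/2 * 9) * 9 \<le> k * L" using K L9 by (intro mult_mono) (auto simp: k_def)
    then show ?thesis by (simp add: N_def k_def)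
  qed
  have R2: "K \<le> 5 * R2" "5 * R2 \<le> K + 4" by (auto simp: R2_def)
  have R: "R2 + 2 * h \<le> 2 * R + 1" "2 * R \<le> R2 + 2 * h" by (auto simp: R_def)
  have Rr: "10 * real R \<le> k + 5 * L - 1"
  proof -
    have "real (2 * R) \<le> real (R2 + 2 * h)" "real (5 * R2) \<le> real (K + 4)" using R R2 by linarith+
    then show ?thesis unfolding L_def k_def by (simp add: field_simps)
  qed
  have Sr: "2 * real S = 5 * L - 1" by (simp add: S_def L_def)
  \<comment> \<open>R is at most about k / 10 + L / 2 and S / 2 about 5 L / 4; \<omega> is the
    resulting bound for W divided by k.\<close>
  define \<omega> where "\<omega> = 1/10 + 7/4 * L / k"
  have W: "W \<le> \<omega> * k" "W \<ge> 0"
  proof -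
    have "W \<le> k / 10 + 7/4 * L" using Rr Sr unfolding W_def by linarith
    moreover have "\<omega> * k = k / 10 + 7/4 * L" using k166 by (simp add: \<omega>_def distrib_right)
    ultimately show "W \<le> \<omega> * k" by simp
  qed (simp add: W_def)
  have \<omega>0: "\<omega> \<ge> 0" using k166 L9 by (simp add: \<omega>_def)
  \<comment> \<open>0.475 rounds up the square root of 0.2592 * 125 / 144, where 0.2592 k bounds 2 R
    + 1 by means of L <= 2 k / 37.\<close>
  define Mb where "Mb = 475/1000 * L ^ 3 * k"
  have Mb0: "Mb \<ge> 0" using L9 k166 by (simp add: Mb_def)
  show False
  proof (rule interpolation_contradiction[OF sol(1,2) _ sol(3) p(1) sol(4,5,6), where K = K and h = h and R = R and S = S and Rd = R2 and Mb = Mb])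
    show "y \<ge> 2" using y by simp
    show "K > 0" using k166 by (simp add: k_def)
    show "S > 0" by (simp add: S_def)
    show "R2 + 2 * h \<le> 2 * R + 1" by (rule R)
    show "(K - 1) * (2 * h + 1) < R2 * (2 * S + 1)"
    proof -
      have "(K - 1) * (2 * h + 1) < K * (2 * h + 1)" using \<open>K > 0\<close> by (intro mult_less_mono1) auto
      also have "\<dots> \<le> (5 * R2) * (2 * h + 1)" using R2 by (intro mult_le_mono1)
      also have "\<dots> = R2 * (2 * S + 1)" by (simp add: S_def algebra_simps)
      finally show ?thesis .
    qed
    show "2 * S + 1 \<le> p"
    proof -
      have "2 * S + 1 \<le> 10 * (1 * (5 * h + 2))" by (simp add: S_def)
      also have "\<dots> \<le> 10 * (h * (5 * h + 2))" using h by (intro mult_le_mono) auto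
      finally show ?thesis using hp by linarith
    qed
    have NN: "real (K * (2 * h + 1)) = N" by (simp add: N_def L_def algebra_simps)
    show "4 * (real h * real S * (6 * exp (- (real p / 2 * v))) / real p) * real (K * (2 * h + 1)) * exp (2 * real (K * (2 * h + 1))) \<le> 1"
    proof -
      have "real (10 * (h * S)) \<le> real p" using hp unfolding S_def by (rule of_nat_mono)
      moreover have "p > 0" using p(1) prime_gt_0_nat by blast
      ultimately have "real h * real S / real p \<le> 1/10" by (simp add: field_simps)
      then have "(real h * real S / real p) * (24 * exp (- (real p / 2 * v)) * N * exp (2 * N)) \<le> 1/10 * (24 * exp (- (real p / 2 * v)) * N * exp (2 * N))"
        using N1 by (intro mult_right_mono) auto
      also have "\<dots> \<le> exp (- (real p / 2 * v)) * (3 * N * exp (2 * N))" using N1 by simp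
      also have "\<dots> \<le> exp (- (real p / 2 * v)) * exp (real p / 2 * v)" using size by (intro mult_left_mono) (auto simp: N_def)
      also have "\<dots> = 1" by (simp add: exp_minus)
      finally show ?thesis unfolding NN by (simp add: field_simps)
    qed
    show "Mb \<ge> 0" by (rule Mb0)
    show "real K * (real h * (real h + 1) * (2 * real h + 1) / 3) * ((2 * real R + 1) * (real S * (real S + 1) * (2 * real S + 1) / 3)) \<le> Mb\<^sup>2"
    proof -
      have h1: "real h * (real h + 1) \<le> L\<^sup>2 / 4" by (simp add: L_def power2_eq_square field_simps)
      have "(2 * real S) * (2 * real S + 2) \<le> 25 * L\<^sup>2" unfolding Sr by (simp add: power2_eq_square algebra_simps)
      then have S1: "real S * (real S + 1) \<le> 25 * L\<^sup>2 / 4" by (simp add: algebra_simps)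
      have S2: "2 * real S + 1 = 5 * L" using Sr by simp
      have h2: "2 * real h + 1 = L" by (simp add: L_def)
      have R1: "2 * real R + 1 \<le> 2592/10000 * k" using Rr K k166 unfolding k_def by linarith
      have "real K * (real h * (real h + 1) * (2 * real h + 1) / 3) * ((2 * real R + 1) * (real S * (real S + 1) * (2 * real S + 1) / 3))
        \<le> k * (L\<^sup>2 / 4 * L / 3) * (2592/10000 * k * (25 * L\<^sup>2 / 4 * (5 * L) / 3))"
        unfolding S2 h2 k_def[symmetric] using h1 S1 R1 L9 k166
        by (intro mult_mono divide_right_mono) (auto intro!: mult_nonneg_nonneg divide_nonneg_nonneg)
      also have "\<dots> = 2592/10000 * (125/144) * (L ^ 3 * k)\<^sup>2" by (simp add: power2_eq_square power3_eq_cube)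
      also have "\<dots> \<le> (475/1000)\<^sup>2 * (L ^ 3 * k)\<^sup>2" by (intro mult_right_mono) (auto simp: power2_eq_square)
      also have "\<dots> = Mb\<^sup>2" unfolding Mb_def by (simp only: power_mult_distrib mult.assoc)
      finally show ?thesis .
    qed
    define q where "q = real p * W * cosh 2 / k + 1"
    have q1: "q \<ge> 1" using W k166 by (simp add: q_def)
    have qs: "q \<le> s\<^sup>2"
    proof -
      have "real p * W * cosh 2 \<le> real p * (\<omega> * k) * (377/100)"
        using W cosh_2_le by (intro mult_mono mult_left_mono) (auto intro!: mult_nonneg_nonneg)
      then have "real p * W * cosh 2 / k \<le> real p * \<omega> * (377/100)" using k166 by (simp add: field_simps)
      then show ?thesis using s(2) unfolding q_def \<omega>_def k_def by linarith
    qed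
    have lnq: "ln q / 2 \<le> s / 53 + 3" "ln q \<ge> 0"
    proof -
      have "ln q \<le> ln (s\<^sup>2)" using qs q1 by (subst ln_le_cancel_iff) auto
      also have "\<dots> = 2 * ln s" using s(1) by (simp add: ln_realpow)
      finally show "ln q / 2 \<le> s / 53 + 3" using ln_le_div_53[OF s(1)] by linarith
      show "ln q \<ge> 0" using q1 by simp
    qed
    \<comment> \<open>Lower-order terms are charged to 0.007 N. The 2, where the gain N (N - 1)
      needs only 1, leaves N to spare and makes the final inequality strict.\<close>
    have T1: "ln (2 * N) + 2 + 1 / N \<le> 7/1000 * N"
    proof -
      have "ln (2 * N) \<le> 2 * N / 2800 + 7" using N1 by (intro ln_le_div_2800) auto
      moreover have "1 / N \<le> 1 / 1000" using N1 by (intro divide_left_mono) auto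
      ultimately show ?thesis using N1 by linarith
    qed
    have T2: "(k - 1) / 2 * ln q \<le> k * (s / 53 + 3)"
    proof -
      have "(k - 1) * (ln q / 2) \<le> k * (s / 53 + 3)" using lnq k166 by (intro mult_mono) auto
      then show ?thesis by simp
    qed
    have T4: "real h * (real h + 1) * (ln (eps\<^sup>2) * W * cosh 2) \<le> 167/100 * L\<^sup>2 * \<omega> * k"
    proof -
      have "ln (eps\<^sup>2) \<ge> 0" by simp
      then have X: "ln (eps\<^sup>2) * W * cosh 2 \<le> 177/100 * (\<omega> * k) * (377/100)"
        using ln_eps_sq_le W cosh_2_le by (intro mult_mono) (auto intro!: mult_nonneg_nonneg)
      have H: "real h * (real h + 1) \<le> L\<^sup>2 / 4" by (simp add: L_def power2_eq_square field_simps)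
      have "real h * (real h + 1) * (ln (eps\<^sup>2) * W * cosh 2) \<le> L\<^sup>2 / 4 * (177/100 * (\<omega> * k) * (377/100))"
        by (rule mult_mono[OF H X]) (use \<open>ln (eps\<^sup>2) \<ge> 0\<close> W in \<open>auto intro!: mult_nonneg_nonneg\<close>)
      also have "\<dots> = 177 * 377 / 40000 * (L\<^sup>2 * \<omega> * k)" by simp
      also have "\<dots> \<le> 167/100 * (L\<^sup>2 * \<omega> * k)" using \<omega>0 k166 by (intro mult_right_mono) auto
      finally show ?thesis by simp
    qed
    \<comment> \<open>Multiplied by N this covers all costs: s / 53 + 3 half of ln q, 3/4 the
      factorials, 1.67 L \<omega> the exponentials, 0.475 L^2 v the arithmetic loss.\<close>
    have main': "k * (s / 53 + 3 + 3/4 + 167/100 * L * \<omega> + 7/1000 * L) + 475/1000 * L\<^sup>2 * v \<le> k * L"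
    proof -
      have "k * (s / 53 + 3 + 3/4 + 167/100 * L * \<omega> + 475/1000 * L\<^sup>2 * v / k + 7/1000 * L) \<le> k * L"
        using main k166 by (intro mult_left_mono) (auto simp: \<omega>_def k_def)
      moreover have "k * (475/1000 * L\<^sup>2 * v / k) = 475/1000 * L\<^sup>2 * v" using k166 by simp
      ultimately show ?thesis by (simp only: distrib_left)
    qed
    have "N * (ln (2 * N) + 2 + 1 / N) \<le> N * (7/1000 * N)" using T1 N1 by (intro mult_left_mono) auto
    then have A: "N * ln (2 * N) + 2 * N + 1 \<le> 7/1000 * N * N" using N1 by (simp add: distrib_left)
    have B: "L * (k * (k - 1) / 2) * ln q \<le> N * (k * (s / 53 + 3))"
      using mult_left_mono[OF T2, of N] N1 by (simp add: N_def k_def mult_ac)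
    have C: "k * (real h * (real h + 1)) * (ln (eps\<^sup>2) * W * cosh 2) \<le> N * (k * (167/100 * L * \<omega>))"
      using mult_left_mono[OF T4, of k] k166 by (simp add: N_def k_def power2_eq_square mult_ac)
    have D: "Mb * v = N * (475/1000 * L\<^sup>2 * v)" by (simp add: Mb_def N_def k_def power2_eq_square power3_eq_cube)
    have "N * (k * (s / 53 + 3 + 3/4 + 167/100 * L * \<omega> + 7/1000 * L) + 475/1000 * L\<^sup>2 * v) \<le> N * (k * L)"
      using main' N1 by (intro mult_left_mono) auto
    then have "7/1000 * N * N + N * (k * (s / 53 + 3)) + 3/4 * L * k\<^sup>2 + N * (k * (167/100 * L * \<omega>)) + N * (475/1000 * L\<^sup>2 * v) \<le> N * N"
      by (simp add: N_def k_def power2_eq_square algebra_simps)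
    then have "N * ln (2 * N) + 1 + L * (k * (k - 1) / 2) * ln q + 3/4 * L * k\<^sup>2 + k * (real h * (real h + 1)) * (ln (eps\<^sup>2) * W * cosh 2) + Mb * v \<le> N * N - 2 * N"
      using A B C D by linarith
    moreover have "N * (N - 1) = N * N - N" by (simp add: algebra_simps)
    ultimately have fin: "N * ln (2 * N) + 1 + L * (k * (k - 1) / 2) * ln q + 3/4 * L * k\<^sup>2 + k * (real h * (real h + 1)) * (ln (eps\<^sup>2) * W * cosh 2) + Mb * v < N * (N - 1)" using N1 by linarith
    have LL: "real (2 * h + 1) = L" by (simp add: L_def)
    show "real (K * (2 * h + 1)) * ln (2 * real (K * (2 * h + 1))) + 1 + real (2 * h + 1) * (real K * (real K - 1) / 2) * ln (real p * (real R + real S / 2) * cosh 2 / real K + 1)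
      + 3 / 4 * real (2 * h + 1) * (real K)\<^sup>2 + real K * (real h * (real h + 1)) * (ln (eps\<^sup>2) * (real R + real S / 2) * cosh 2) + Mb * ln (of_int y)
      < real (K * (2 * h + 1)) * (real (K * (2 * h + 1)) - 1)"
      unfolding NN LL k_def[symmetric] W_def[symmetric] v_def[symmetric] q_def[symmetric] by (rule fin)
  qed
qed

text \<open>Two decimals matter: K >= 37/2 L needs 5.95 v to exceed 18.5 by a margin, and 5.95 *
  3.13 = 18.62.\<close>

lemma ln_23_ge: "ln (23::real) \<ge> 313/100"
proof -
  have "exp (313/100 :: real) = exp 1 ^ 3 * exp (13/200) ^ 2"
    unfolding exp_of_nat_mult[symmetric] exp_add[symmetric] by simp
  also have "\<dots> \<le> (27187/10000) ^ 3 * (1 + 13/200 + (13/200)\<^sup>2) ^ 2"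
    using exp_1_bounds by (intro mult_mono power_mono exp_bound) auto
  also have "\<dots> \<le> 23" by (simp add: power_divide power2_eq_square power3_eq_cube)
  finally have "ln (exp (313/100)) \<le> ln (23::real)" by (subst ln_le_cancel_iff) auto
  then show ?thesis by simp
qed

text \<open>Here 2 K L <= 11.9 L^2 v while p v / 2 >= 12 L^2 v; the surplus 0.1 L^2 v absorbs the
  factor 3 K L. Since 1952 > 24 * 9^2, the choice of \<open>h\<close> gives h >= 4.\<close>

lemma no_solution_large_exponent:
  fixes x y :: int and p :: nat
  assumes eq: "x\<^sup>2 - 2 = y ^ p" and p: "prime p" "p \<ge> 1952" and x: "x > 0" and y: "y \<ge> 23"
  shows False
proof -
  \<comment> \<open>The largest h with 24 (2 h + 1)^2 <= p, described through the failure at h +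
    1.\<close>
  define h where "h = (LEAST n. p < 24 * (2 * n + 3)\<^sup>2)"
  have "p < 24 * (2 * p + 3)\<^sup>2" by (simp add: power2_eq_square algebra_simps)
  then have h1: "p < 24 * (2 * h + 3)\<^sup>2" unfolding h_def by (rule LeastI)
  have h4: "h \<ge> 4"
  proof (rule ccontr)
    assume "\<not> h \<ge> 4"
    then have "(2 * h + 3)\<^sup>2 \<le> 9\<^sup>2" by (intro power_mono) auto
    then show False using h1 p(2) by simp
  qed
  have h2: "24 * (2 * h + 1)\<^sup>2 \<le> p"
  proof -
    have "\<not> p < 24 * (2 * (h - 1) + 3)\<^sup>2" using not_less_Least[of "h - 1" "\<lambda>n. p < 24 * (2 * n + 3)\<^sup>2"] h4 by (simp add: h_def)
    moreover have "2 * (h - 1) + 3 = 2 * h + 1" using h4 by simp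
    ultimately show ?thesis by (simp only: not_less)
  qed
  define L where "L = 2 * real h + 1"
  define v where "v = ln (real_of_int y)"
  have "ln 23 \<le> v" unfolding v_def using y by (subst ln_le_cancel_iff) auto
  then have v: "v \<ge> 313/100" using ln_23_ge by linarith
  have L9: "L \<ge> 9" using h4 by (simp add: L_def)
  have pL: "24 * L\<^sup>2 \<le> real p" "real p \<le> 24 * (L + 2)\<^sup>2"
  proof -
    have "real (24 * (2 * h + 1)\<^sup>2) \<le> real p" using h2 by (rule of_nat_mono)
    moreover have "real (2 * h + 1) = L" "real (2 * h + 3) = L + 2" by (simp_all add: L_def)
    ultimately show "24 * L\<^sup>2 \<le> real p" by (simp only: of_nat_mult of_nat_power of_nat_numeral)
    have "real p \<le> real (24 * (2 * h + 3)\<^sup>2)" using h1 by (intro of_nat_mono) simp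
    then show "real p \<le> 24 * (L + 2)\<^sup>2"
      using \<open>real (2 * h + 3) = L + 2\<close> by (simp only: of_nat_mult of_nat_power of_nat_numeral)
  qed
  define K where "K = nat \<lfloor>595/100 * (L * v)\<rfloor>"
  have Lv: "L * (313/100) \<le> L * v" using v L9 by (intro mult_left_mono) auto
  then have Lv0: "0 \<le> L * v" using L9 by linarith
  have K: "real K \<le> 595/100 * (L * v)" "595/100 * (L * v) < real K + 1"
    unfolding K_def using Lv0 by linarith+
  have KL: "real K \<ge> 37/2 * L" using K(2) Lv L9 by linarith
  have K0: "real K > 0" using KL L9 by linarith
  have LK: "L / real K \<le> 2/37" using KL K0 by (simp add: field_simps)
  have p0: "real p \<ge> 1952" using p(2) by simp
  show False
  proof (rule no_solution_of_parameters[OF eq p(1) _ x, where h = h and K = K and s = "21/5 * (L + 2)"])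
    show "odd p" using p prime_odd_nat[of p] by auto
    show "y \<ge> 7" using y by simp
    show "h \<ge> 4" by (rule h4)
    show "10 * (h * (5 * h + 2)) \<le> p"
    proof -
      have "10 * (h * (5 * h + 2)) \<le> 24 * (2 * h + 1)\<^sup>2" by (simp add: power2_eq_square algebra_simps)
      then show ?thesis using h2 by linarith
    qed
    show "37/2 * (2 * real h + 1) \<le> real K" using KL by (simp add: L_def)
    show "3 * (real K * (2 * real h + 1)) * exp (2 * (real K * (2 * real h + 1))) \<le> exp (real p / 2 * ln (real_of_int y))"
    proof -
      define t where "t = L\<^sup>2 * v / 10"
      have "81 * (313/100) \<le> L\<^sup>2 * v" using v L9 power_mono[of 9 L 2] by (intro mult_mono) auto
      then have t25: "t \<ge> 25" unfolding t_def by linarith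
      have N: "real K * L \<le> 119/2 * t"
      proof -
        have "real K * L \<le> 595/100 * (L * v) * L" using K(1) L9 by (intro mult_right_mono) auto
        then show ?thesis by (simp add: t_def power2_eq_square mult_ac)
      qed
      have P: "120 * t \<le> real p / 2 * v"
      proof -
        have "24 * L\<^sup>2 * v \<le> real p * v" using pL v by (intro mult_right_mono) auto
        then show ?thesis by (simp add: t_def mult_ac)
      qed
      have "3 * (real K * L) \<le> exp t"
      proof -
        have "3 * (real K * L) \<le> 357/2 * t" using N by linarith
        also have "\<dots> \<le> (t / 8) ^ 7 * (t / 8)"
        proof -
          have "(25/8) ^ 7 \<le> (t / 8) ^ 7" using t25 by (intro power_mono) auto
          then have "1428 \<le> (t / 8) ^ 7" by (simp add: power_divide)
          then have "1428 * (t / 8) \<le> (t / 8) ^ 7 * (t / 8)" using t25 by (intro mult_right_mono) auto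
          then show ?thesis by simp
        qed
        also have "\<dots> = (t / 8) ^ 8" by (simp add: eval_nat_numeral)
        also have "\<dots> \<le> exp (t / 8) ^ 8"
        proof (rule power_mono)
          show "t / 8 \<le> exp (t / 8)" using exp_ge_add_one_self[of "t / 8"] by linarith
        qed (use t25 in simp)
        also have "\<dots> = exp t" unfolding exp_of_nat_mult[symmetric] by simp
        finally show ?thesis .
      qed
      then have "3 * (real K * L) * exp (2 * (real K * L)) \<le> exp t * exp (119 * t)"
        using N K0 L9 by (intro mult_mono) auto
      also have "\<dots> = exp (120 * t)" unfolding exp_add[symmetric] by simp
      also have "\<dots> \<le> exp (real p / 2 * v)" using P by simp
      finally show ?thesis by (simp add: L_def v_def)
    qed
    \<comment> \<open>(21/5)^2 = 24 * 0.735, where p <= 24 (L + 2)^2 and 0.735 is slightly above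
      0.1946 * 3.77.\<close>
    show "21/5 * (L + 2) > 0" using L9 by simp
    show "real p * (1/10 + 7/4 * (2 * real h + 1) / real K) * (377/100) + 1 \<le> (21/5 * (L + 2))\<^sup>2"
    proof -
      have "1/10 + 7/4 * L / real K \<le> 1946/10000" using LK by simp
      then have "real p * (1/10 + 7/4 * L / real K) * (377/100) \<le> real p * (1946/10000) * (377/100)"
        by (intro mult_right_mono mult_left_mono) auto
      also have "\<dots> + 1 \<le> 735/1000 * real p" using p0 by linarith
      also have "\<dots> \<le> 735/1000 * (24 * (L + 2)\<^sup>2)" using pL by (intro mult_left_mono) auto
      also have "\<dots> = (21/5 * (L + 2))\<^sup>2"
      proof -
        have "(21/5 :: real)\<^sup>2 = 735/1000 * 24" by (simp add: power2_eq_square)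
        then show ?thesis by (simp only: power_mult_distrib mult.assoc)
      qed
      finally show ?thesis by (simp add: L_def)
    qed
    show "21/5 * (L + 2) / 53 + 3 + 3/4 + 167/100 * (2 * real h + 1) * (1/10 + 7/4 * (2 * real h + 1) / real K)
      + 475/1000 * (2 * real h + 1)\<^sup>2 * ln (real_of_int y) / real K + 7/1000 * (2 * real h + 1) \<le> 2 * real h + 1"
    proof -
      have a: "167/100 * L * (1/10 + 7/4 * L / real K) \<le> 167/100 * L * (1946/10000)"
        using LK L9 by (intro mult_left_mono) auto
      have b: "475/1000 * L\<^sup>2 * v / real K \<le> 81/1000 * L"
      proof -
        have "L * v \<le> (real K + 1) * 100/595" using K(2) by simp
        also have "\<dots> \<le> 170/1000 * real K" using KL L9 by simp
        finally have "475/1000 * L * (L * v) \<le> 475/1000 * L * (170/1000 * real K)" using L9 by (intro mult_left_mono) auto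
        then have "475/1000 * L\<^sup>2 * v \<le> 475/1000 * (170/1000) * L * real K" by (simp add: power2_eq_square mult_ac)
        also have "\<dots> \<le> 81/1000 * L * real K" using L9 K0 by (intro mult_right_mono) auto
        finally show ?thesis using K0 by (simp add: divide_le_eq)
      qed
      have "21/5 * (L + 2) / 53 = 21/265 * L + 42/265" by simp
      then have "21/5 * (L + 2) / 53 + 3 + 3/4 + 167/100 * L * (1/10 + 7/4 * L / real K) + 475/1000 * L\<^sup>2 * v / real K + 7/1000 * L \<le> L"
        using a b L9 by linarith
      then show ?thesis by (simp only: L_def v_def)
    qed
  qed
qed

text \<open>With L = 9 and K at most 25 v, 2 K L <= 450 v; another 6 v absorbs the polynomial
  factor, and 456 = 912 / 2. As v >= 100, the rounding of K and the terms in L / K are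
  negligible.\<close>

lemma no_solution_large_base:
  fixes x y :: int and p :: nat
  assumes eq: "x\<^sup>2 - 2 = y ^ p" and p: "prime p" "912 \<le> p" "p \<le> 1951" and x: "x > 0" and y: "y \<ge> 10 ^ 50"
  shows False
proof -
  define v where "v = ln (real_of_int y)"
  have v: "v \<ge> 100"
  proof -
    have "exp (2::real) = exp 1 ^ 2" using exp_real_of_nat[of 2] by simp
    also have "\<dots> \<le> 3 ^ 2" using exp_le by (intro power_mono) auto
    finally have "ln (exp 2) \<le> ln (10::real)" by (subst ln_le_cancel_iff) auto
    moreover have "ln ((10::real) ^ 50) = real 50 * ln 10" by (rule ln_realpow)
    ultimately have "100 \<le> ln ((10::real) ^ 50)" by (simp only:) simp
    also have "\<dots> \<le> v" unfolding v_def
    proof (subst ln_le_cancel_iff)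
      have "real_of_int (10 ^ 50) \<le> real_of_int y" using y by (simp only: of_int_le_iff)
      then show "(10::real) ^ 50 \<le> real_of_int y" "0 < real_of_int y" by auto
    qed auto
    finally show ?thesis .
  qed
  define K where "K = nat \<lfloor>25 * v\<rfloor>"
  have K: "real K \<le> 25 * v" "25 * v < real K + 1" unfolding K_def using v by linarith+
  have K1: "real K \<ge> 2499" using K(2) v by linarith
  have pr: "real p \<ge> 912" "real p \<le> 1951" using p by auto
  show False
  proof (rule no_solution_of_parameters[OF eq p(1) _ x, where h = 4 and K = K and s = 30])
    show "odd p" using p prime_odd_nat[of p] by auto
    show "y \<ge> 7" using y by simp
    show "10 * (4 * (5 * 4 + 2)) \<le> p" using p by simp
    show "37/2 * (2 * real 4 + 1) \<le> real K" using K1 by simp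
    show "3 * (real K * (2 * real 4 + 1)) * exp (2 * (real K * (2 * real 4 + 1))) \<le> exp (real p / 2 * ln (real_of_int y))"
    proof -
      have "3 * (real K * 9) \<le> 675 * v" using K by linarith
      also have "\<dots> \<le> v ^ 2 * v"
      proof -
        have "100 ^ 2 \<le> v ^ 2" using v by (intro power_mono) auto
        then show ?thesis using v by (intro mult_right_mono) auto
      qed
      also have "\<dots> = v ^ 3" by (simp add: eval_nat_numeral)
      also have "\<dots> \<le> exp v ^ 3"
      proof (rule power_mono)
        show "v \<le> exp v" using exp_ge_add_one_self[of v] by linarith
      qed (use v in simp)
      also have "\<dots> \<le> exp v ^ 6" using v by (intro power_increasing) auto
      also have "\<dots> = exp (6 * v)" unfolding exp_of_nat_mult[symmetric] by simp
      finally have "3 * (real K * 9) \<le> exp (6 * v)" .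
      then have "3 * (real K * 9) * exp (2 * (real K * 9)) \<le> exp (6 * v) * exp (450 * v)"
        using K by (intro mult_mono) auto
      also have "\<dots> = exp (456 * v)" unfolding exp_add[symmetric] by simp
      also have "\<dots> \<le> exp (real p / 2 * v)"
      proof -
        have "456 * v \<le> real p / 2 * v" using pr v by (intro mult_right_mono) auto
        then show ?thesis by simp
      qed
      finally show ?thesis by (simp add: v_def)
    qed
    have K2: "63/4 / real K \<le> 64/10000" using K1 by (simp add: divide_le_eq)
    have w: "1/10 + 7/4 * (2 * real 4 + 1) / real K \<le> 1064/10000" using K2 by simp
    show "real p * (1/10 + 7/4 * (2 * real 4 + 1) / real K) * (377/100) + 1 \<le> 30\<^sup>2"
    proof -
      have "real p * (1/10 + 7/4 * (2 * real 4 + 1) / real K) * (377/100) \<le> 1951 * (1064/10000) * (377/100)"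
        using w pr K1 by (intro mult_right_mono mult_mono) auto
      then show ?thesis by simp
    qed
    show "30 / 53 + 3 + 3/4 + 167/100 * (2 * real 4 + 1) * (1/10 + 7/4 * (2 * real 4 + 1) / real K)
      + 475/1000 * (2 * real 4 + 1)\<^sup>2 * ln (real_of_int y) / real K + 7/1000 * (2 * real 4 + 1) \<le> 2 * real 4 + 1"
    proof -
      have "v / real K \<le> 401/10000" using K K1 by (simp add: divide_le_eq)
      then have b: "475/1000 * (2 * real 4 + 1)\<^sup>2 * v / real K \<le> 475/1000 * 81 * (401/10000)" by simp
      define X where "X = 1/10 + 7/4 * (2 * real 4 + 1) / real K"
      define B where "B = 475/1000 * (2 * real 4 + 1)\<^sup>2 * v / real K"
      have "30 / 53 + 3 + 3/4 + 167/100 * 9 * X + B + 7/1000 * 9 \<le> 9"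
        using w b unfolding X_def[symmetric] B_def[symmetric] by linarith
      moreover have "2 * real 4 + 1 = 9" by simp
      ultimately show ?thesis by (simp only: X_def B_def v_def)
    qed
  qed auto
qed

text \<open>Modulo 8 only y = 7, 15, 23, ... remain among positive y; 15 falls modulo 3, and 7 by
  the Pell equation. A negative y other than -1 would give y^p <= -8, below x^2 - 2.\<close>

lemma nontrivial_base_ge_23:
  fixes x y :: int and p :: nat
  assumes eq: "x\<^sup>2 - 2 = y ^ p" and p: "odd p" "p \<ge> 3" and y: "y \<noteq> -1"
  shows "y \<ge> 23 \<and> x \<noteq> 0"
proof -
  have mod4: "x\<^sup>2 mod 4 = 0 \<or> x\<^sup>2 mod 4 = 1"
  proof -
    have "x mod 4 \<in> {0, 1, 2, 3}" by auto
    then have "(x mod 4)\<^sup>2 mod 4 = 0 \<or> (x mod 4)\<^sup>2 mod 4 = 1" by auto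
    then show ?thesis unfolding power_mod .
  qed
  have oddy: "odd y"
  proof
    assume "even y"
    then have "y ^ 2 dvd y ^ p" using p by (intro le_imp_power_dvd) auto
    moreover have "(4::int) dvd y ^ 2" using \<open>even y\<close> by (auto elim!: evenE simp: power_mult_distrib)
    ultimately have "4 dvd y ^ p" by (rule dvd_trans[rotated])
    then have "4 dvd x\<^sup>2 - 2" using eq by simp
    moreover have "a mod 4 = 2" if "4 dvd a - 2" for a :: int using that by presburger
    ultimately have "x\<^sup>2 mod 4 = 2" by blast
    then show False using mod4 by simp
  qed
  obtain k where k: "p = 2 * k + 1" using p(1) by (auto elim: oddE)
  have odd_sq: "z\<^sup>2 mod 8 = 1" if "odd z" for z :: int
  proof -
    have "z mod 8 \<in> {1, 3, 5, 7}" using that by auto presburger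
    then have "(z mod 8)\<^sup>2 mod 8 = 1" by auto
    then show ?thesis unfolding power_mod .
  qed
  have "y ^ p mod 8 = y mod 8"
  proof -
    have "y ^ p mod 8 = (y\<^sup>2 mod 8) ^ k * y mod 8" unfolding k power_add power_mult
      by (metis mod_mult_left_eq power_mod power_one_right)
    then show ?thesis using odd_sq[OF oddy] by simp
  qed
  moreover have "odd x"
  proof -
    have "odd (y ^ p)" using oddy by simp
    then have "odd (x\<^sup>2 - 2)" using eq by simp
    then show ?thesis by simp
  qed
  then have "x\<^sup>2 mod 8 = 1" by (rule odd_sq)
  moreover have "(a - 2) mod 8 = 7" if "a mod 8 = 1" for a :: int using that by presburger
  ultimately have y8: "y mod 8 = 7" using eq by metis
  have y3: "\<not> 3 dvd y"
  proof
    assume "3 dvd y"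
    then have "3 dvd y ^ p" using p dvd_trans[OF _ dvd_power[of p y]] by auto
    then have "3 dvd x\<^sup>2 - 2" using eq by simp
    moreover have "a mod 3 = 2" if "3 dvd a - 2" for a :: int using that by presburger
    ultimately have "x\<^sup>2 mod 3 = 2" by blast
    moreover have "x mod 3 \<in> {0, 1, 2}" by auto
    then have "(x mod 3)\<^sup>2 mod 3 \<noteq> 2" by auto
    then have "x\<^sup>2 mod 3 \<noteq> 2" unfolding power_mod .
    ultimately show False by simp
  qed
  have "y > 0"
  proof (rule ccontr)
    assume "\<not> y > 0"
    then have "y \<le> -2" using y8 y by presburger
    then have "2 \<le> - y" by simp
    then have "(2::int) ^ 3 \<le> (- y) ^ 3" by (intro power_mono) auto
    also have "\<dots> \<le> (- y) ^ p" using \<open>2 \<le> - y\<close> p by (intro power_increasing) auto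
    finally have "y ^ p \<le> - 8" using p(1) by simp
    moreover have "x\<^sup>2 \<ge> 0" by simp
    ultimately show False using eq by linarith
  qed
  have "y \<noteq> 7" using no_solution_base_7[of p x] eq p by auto
  have "y \<noteq> 15" using y3 by auto
  have "y \<ge> 23" using \<open>y > 0\<close> \<open>y \<noteq> 7\<close> \<open>y \<noteq> 15\<close> y8 by presburger
  then show ?thesis using \<open>odd x\<close> by auto
qed

theorem theorem5p1:
  fixes p :: nat and x y :: int
  assumes "prime p" and "p \<ge> 3"
    and "x^2 - 2 = y^p" and "y \<noteq> -1"
  shows "p \<le> 1951 \<and>
    (911 < p \<and> p \<le> 1951 \<longrightarrow>
      (p = 919 \<longrightarrow> y < 10^800) \<and>
      (p = 929 \<longrightarrow> y < 10^300) \<and>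
      (p \<in> {937, 941} \<longrightarrow> y < 10^150) \<and>
      (947 \<le> p \<and> p \<le> 1200 \<longrightarrow> y < 10^100) \<and>
      (1200 \<le> p \<and> p \<le> 1951 \<longrightarrow> y < 10^50))"
proof -
  have "odd p" using assms prime_odd_nat[of p] by auto
  then have y: "y \<ge> 23" and x: "\<bar>x\<bar> > 0" using nontrivial_base_ge_23[OF assms(3) _ assms(2,4)] by auto
  have eq: "\<bar>x\<bar>\<^sup>2 - 2 = y ^ p" using assms(3) by simp
  have p: "p \<le> 1951" using no_solution_large_exponent[OF eq assms(1) _ x y] by (cases "p \<le> 1951") auto
  have small: "y < 10 ^ 50" if "911 < p" using no_solution_large_base[OF eq assms(1) _ p x] that by (cases "y < 10 ^ 50") auto
  \<comment> \<open>The bound 10^50 holds for every p above 911, so each of the five ranges follows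
    by monotonicity in the exponent of 10.\<close>
  have bound: "y < 10 ^ k" if "911 < p" "50 \<le> k" for k
  proof -
    have "(10::int) ^ 50 \<le> 10 ^ k" using that by (intro power_increasing) auto
    then show ?thesis using small[OF that(1)] by linarith
  qed
  show ?thesis by (intro conjI impI bound p) auto
qed

end
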